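(* Let $\mathcal M=(M,<,+,0,\ldots)$ be a DCULOAS structure. Let $C\subseteq M^m$ be a definable closed and bounded set, $P\subseteq M^n$ a definable set, and $\pi:C\times P\rightarrow P$ the projection. Let $f:C\times P\rightarrow M$ be a definable function which is equi-continuous with respect to $P$, and set $D=\{(x,q)\in C\times P\;|\; f\text{ is discontinuous at }(x,q)\}$. Then $\dim \pi(D)<\dim P$.
   Context: "Definable" means definable in $\mathcal M$ with parameters. A DCULOAS structure is a definably complete uniformly locally o-minimal expansion of the second kind of a densely linearly ordered abelian group $(M,<,+,0)$: definably complete means every definable subset of $M$ has a supremum and infimum in $M\cup\{\pm\infty\}$; uniformly locally o-minimal of the second kind means that for every definable $X\subseteq M^{n+1}$, $a\in M$, $b\in M^n$ there are an open interval $I\ni a$ and an open box $B\ni b$ such that for all $y\in B$ the set $\{x: (y,x)\in X\}\cap I$ is a finite union of points and open intervals. $M^n$ has the product order topology, $|x|=\max_i|x_i|$. The dimension of a nonempty definable $X\subseteq M^n$ is the largest $d$ such that for some coordinate projection $\rho:M^n\to M^d$ the image $\rho(X)$ has nonempty interior in $M^d$ (with $\dim\emptyset=-\infty$). $f:C\times P\to M$ is equi-continuous with respect to $P$ if $\forall\varepsilon>0\,\forall x\in C\,\exists\delta>0\,\forall p\in P\,\forall x'\in C$, $|x-x'|<\delta\Rightarrow|f(x,p)-f(x',p)|<\varepsilon$.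
   Formalization: The set P is assumed nonempty: for P empty both dimensions are −∞ and the strict inequality dim π(D) < dim P fails. *)

theory Defs
  imports
    "HOL-Analysis.Analysis"
    "HOL-Library.Extended"
    "HOL-Library.Lub_Glb"
begin

text \<open>
  The universe of the structure is a whole type. The absolute value and the topology are
  included for the sake of the library; by the class axioms both are determined by the
  ordered group.
\<close>

class dense_linordered_ab_group =
  linordered_ab_group_add + ordered_ab_group_add_abs + dense_linorder + linorder_topology


text \<open>
  \<open>'f\<close> and \<open>'r\<close> are the additional function and relation symbols. A symbol may be applied to
  argument lists of every length, so it stands for one symbol of each arity. A language with
  fixed arities is covered by interpreting the other arities by constants.
\<close>

datatype 'f trm = Var nat | Zero | Add "'f trm" "'f trm" | App 'f "'f trm list"

datatype ('f, 'r) fm =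
    Eq "'f trm" "'f trm"
  | Less "'f trm" "'f trm"
  | Rel 'r "'f trm list"
  | Neg "('f, 'r) fm"
  | Conj "('f, 'r) fm" "('f, 'r) fm"
  | Ex nat "('f, 'r) fm"

record ('a, 'f, 'r) expansion =
  fun_of :: "'f \<Rightarrow> 'a list \<Rightarrow> 'a"
  rel_of :: "'r \<Rightarrow> 'a list \<Rightarrow> bool"

primrec trm_val ::
  "('a::dense_linordered_ab_group, 'f, 'r) expansion \<Rightarrow> (nat \<Rightarrow> 'a) \<Rightarrow> 'f trm \<Rightarrow> 'a" where
  "trm_val \<M> e (Var i) = e i"
| "trm_val \<M> e Zero = 0"
| "trm_val \<M> e (Add s t) = trm_val \<M> e s + trm_val \<M> e t"
| "trm_val \<M> e (App g ts) = fun_of \<M> g (map (trm_val \<M> e) ts)"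

primrec sat ::
  "('a::dense_linordered_ab_group, 'f, 'r) expansion \<Rightarrow> (nat \<Rightarrow> 'a) \<Rightarrow> ('f, 'r) fm \<Rightarrow> bool" where
  "sat \<M> e (Eq s t) \<longleftrightarrow> trm_val \<M> e s = trm_val \<M> e t"
| "sat \<M> e (Less s t) \<longleftrightarrow> trm_val \<M> e s < trm_val \<M> e t"
| "sat \<M> e (Rel r ts) \<longleftrightarrow> rel_of \<M> r (map (trm_val \<M> e) ts)"
| "sat \<M> e (Neg \<phi>) \<longleftrightarrow> \<not> sat \<M> e \<phi>"
| "sat \<M> e (Conj \<phi> \<psi>) \<longleftrightarrow> sat \<M> e \<phi> \<and> sat \<M> e \<psi>"
| "sat \<M> e (Ex i \<phi>) \<longleftrightarrow> (\<exists>a. sat \<M> (e(i := a)) \<phi>)"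

text \<open>Points of \<open>M\<^sup>n\<close> are the functions on \<open>{..<n}\<close> that are \<open>undefined\<close> elsewhere.\<close>

abbreviation cart :: "nat \<Rightarrow> (nat \<Rightarrow> 'a) set" where
  "cart n \<equiv> {..<n} \<rightarrow>\<^sub>E UNIV"

text \<open>
  The variables below \<open>n\<close> range over the point, the other free variables of the formula are
  parameters with values given by \<open>e\<close>.
\<close>

definition definable ::
  "('a::dense_linordered_ab_group, 'f, 'r) expansion \<Rightarrow> nat \<Rightarrow> (nat \<Rightarrow> 'a) set \<Rightarrow> bool" where
  "definable \<M> n X \<longleftrightarrow> (\<exists>\<phi> e. X = {x \<in> cart n. sat \<M> (override_on e x {..<n}) \<phi>})"

definition join :: "nat \<Rightarrow> nat \<Rightarrow> (nat \<Rightarrow> 'a) \<Rightarrow> (nat \<Rightarrow> 'a) \<Rightarrow> nat \<Rightarrow> 'a" where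
  "join m n x y = (\<lambda>i\<in>{..<m + n}. if i < m then x i else y (i - m))"

text \<open>A function \<open>C \<times> P \<rightarrow> M\<close> is definable if its graph, a subset of \<open>M\<^bsup>m+n+1\<^esup>\<close>, is definable.\<close>

definition definable_fun ::
  "('a::dense_linordered_ab_group, 'f, 'r) expansion \<Rightarrow> nat \<Rightarrow> nat \<Rightarrow>
    (nat \<Rightarrow> 'a) set \<Rightarrow> (nat \<Rightarrow> 'a) set \<Rightarrow> ((nat \<Rightarrow> 'a) \<times> (nat \<Rightarrow> 'a) \<Rightarrow> 'a) \<Rightarrow> bool" where
  "definable_fun \<M> m n C P f \<longleftrightarrow>
    definable \<M> (Suc (m + n)) {(join m n x p)(m + n := f (x, p)) |x p. x \<in> C \<and> p \<in> P}"


definition open_interval :: "'a::linorder set \<Rightarrow> bool" where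
  "open_interval I \<longleftrightarrow> (\<exists>l u :: 'a extended. I = {a. l < Fin a \<and> Fin a < u})"

definition open_box :: "nat \<Rightarrow> (nat \<Rightarrow> 'a::linorder) set \<Rightarrow> bool" where
  "open_box n B \<longleftrightarrow> (\<exists>J. (\<forall>i<n. open_interval (J i)) \<and> B = (\<Pi>\<^sub>E i\<in>{..<n}. J i))"

definition fin_union_points_intervals :: "'a::linorder set \<Rightarrow> bool" where
  "fin_union_points_intervals X \<longleftrightarrow>
    (\<exists>F \<J>. finite F \<and> finite \<J> \<and> (\<forall>J\<in>\<J>. open_interval J) \<and> X = F \<union> \<Union>\<J>)"

definition definably_complete ::
  "('a::dense_linordered_ab_group, 'f, 'r) expansion \<Rightarrow> bool" where
  "definably_complete \<M> \<longleftrightarrow>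
    (\<forall>X. definable \<M> 1 {x \<in> cart 1. x 0 \<in> X} \<longrightarrow>
      (\<exists>s :: 'a extended. isLub UNIV (Fin ` X) s) \<and>
      (\<exists>s :: 'a extended. isGlb UNIV (Fin ` X) s))"

definition unif_locally_o_minimal_2nd ::
  "('a::dense_linordered_ab_group, 'f, 'r) expansion \<Rightarrow> bool" where
  "unif_locally_o_minimal_2nd \<M> \<longleftrightarrow>
    (\<forall>n X a. \<forall>b \<in> cart n. definable \<M> (Suc n) X \<longrightarrow>
      (\<exists>I B. open_interval I \<and> a \<in> I \<and> open_box n B \<and> b \<in> B \<and>
        (\<forall>y\<in>B. fin_union_points_intervals ({x. y(n := x) \<in> X} \<inter> I))))"

definition DCULOAS :: "('a::dense_linordered_ab_group, 'f, 'r) expansion \<Rightarrow> bool" where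
  "DCULOAS \<M> \<longleftrightarrow> definably_complete \<M> \<and> unif_locally_o_minimal_2nd \<M>"


definition cart_top :: "nat \<Rightarrow> (nat \<Rightarrow> 'a::topological_space) topology" where
  "cart_top n = product_topology (\<lambda>_. euclidean) {..<n}"

text \<open>\<open>0\<close> is inserted only to cover \<open>m = 0\<close>.\<close>

definition max_norm :: "nat \<Rightarrow> (nat \<Rightarrow> 'a::dense_linordered_ab_group) \<Rightarrow> 'a" where
  "max_norm m x = Max (insert 0 ((\<lambda>i. \<bar>x i\<bar>) ` {..<m}))"

definition bounded_in :: "nat \<Rightarrow> (nat \<Rightarrow> 'a::dense_linordered_ab_group) set \<Rightarrow> bool" where
  "bounded_in m C \<longleftrightarrow> (\<exists>r. \<forall>x\<in>C. max_norm m x \<le> r)"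

definition coord_proj :: "nat \<Rightarrow> (nat \<Rightarrow> nat) \<Rightarrow> (nat \<Rightarrow> 'a) \<Rightarrow> nat \<Rightarrow> 'a" where
  "coord_proj d \<sigma> x = (\<lambda>i\<in>{..<d}. x (\<sigma> i))"

text \<open>
  \<open>Minf\<close> is the dimension \<open>-\<infinity>\<close> of the empty set. For nonempty \<open>X \<subseteq> M\<^sup>n\<close> the maximum is over
  a set that contains \<open>0\<close> and is bounded by \<open>n\<close>.
\<close>

definition proj_dims :: "nat \<Rightarrow> (nat \<Rightarrow> 'a::dense_linordered_ab_group) set \<Rightarrow> nat set" where
  "proj_dims n X = {d. \<exists>\<sigma>. strict_mono_on {..<d} \<sigma> \<and> \<sigma> ` {..<d} \<subseteq> {..<n} \<and>
    cart_top d interior_of (coord_proj d \<sigma> ` X) \<noteq> {}}"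

definition def_dim ::
  "nat \<Rightarrow> (nat \<Rightarrow> 'a::dense_linordered_ab_group) set \<Rightarrow> nat extended" where
  "def_dim n X = (if X = {} then Minf else Fin (Max (proj_dims n X)))"

lemma proj_dims_le: "d \<in> proj_dims n X \<Longrightarrow> d \<le> n"
proof -
  assume "d \<in> proj_dims n X"
  then obtain \<sigma> :: "nat \<Rightarrow> nat"
    where \<sigma>: "strict_mono_on {..<d} \<sigma>" "\<sigma> ` {..<d} \<subseteq> {..<n}"
    by (auto simp: proj_dims_def)
  have "card {..<d} \<le> card {..<n}"
    by (rule card_inj_on_le[OF strict_mono_on_imp_inj_on]) (use \<sigma> in auto)
  then show ?thesis by simp
qed

lemma finite_proj_dims: "finite (proj_dims n X)"
  by (rule finite_subset[of _ "{..n}"]) (auto dest: proj_dims_le)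

lemma zero_in_proj_dims:
  assumes "X \<noteq> {}"
  shows "0 \<in> proj_dims n X"
proof -
  have "coord_proj 0 id ` X = topspace (cart_top 0 :: (nat \<Rightarrow> 'a) topology)"
    using assms by (auto simp: coord_proj_def cart_top_def restrict_def image_iff)
  then have "cart_top 0 interior_of (coord_proj 0 id ` X) = topspace (cart_top 0)"
    by simp
  also have "\<dots> \<noteq> {}" by (simp add: cart_top_def)
  finally show ?thesis by (auto simp: proj_dims_def strict_mono_on_def)
qed

definition equi_continuous_wrt ::
  "nat \<Rightarrow> (nat \<Rightarrow> 'a::dense_linordered_ab_group) set \<Rightarrow> (nat \<Rightarrow> 'a) set \<Rightarrow>
    ((nat \<Rightarrow> 'a) \<times> (nat \<Rightarrow> 'a) \<Rightarrow> 'a) \<Rightarrow> bool" where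
  "equi_continuous_wrt m C P f \<longleftrightarrow>
    (\<forall>\<epsilon>>0. \<forall>x\<in>C. \<exists>\<delta>>0. \<forall>p\<in>P. \<forall>x'\<in>C.
      max_norm m (\<lambda>i. x i - x' i) < \<delta> \<longrightarrow> \<bar>f (x, p) - f (x', p)\<bar> < \<epsilon>)"

definition discontinuity_set ::
  "nat \<Rightarrow> nat \<Rightarrow> (nat \<Rightarrow> 'a::dense_linordered_ab_group) set \<Rightarrow> (nat \<Rightarrow> 'a) set \<Rightarrow>
    ((nat \<Rightarrow> 'a) \<times> (nat \<Rightarrow> 'a) \<Rightarrow> 'a) \<Rightarrow> ((nat \<Rightarrow> 'a) \<times> (nat \<Rightarrow> 'a)) set" where
  "discontinuity_set m n C P f =
    {z \<in> C \<times> P. \<not> topcontinuous_at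
      (subtopology (prod_topology (cart_top m) (cart_top n)) (C \<times> P)) euclidean f z}"

end

(*
  All topology is expressed through "X contains a box". In one variable, uniform local
  o-minimality gives two Baire properties (a monotone definable family whose union contains an
  interval has a member that contains one) and the fact that a definable function is, up to
  any given eps > 0, constant on some interval. An induction on the number of variables carries
  these over to boxes, together with the Kuratowski-Ulam property: a definable set with many
  fibres that contain an interval contains a box.

  If the projection E of the discontinuity set had the dimension d of P, some projection to d
  coordinates would map E onto a set containing a box. By Kuratowski-Ulam the fibres of P over
  a smaller box are discrete. Baire makes three quantities uniform: the radius k in which the
  points of P are isolated in their fibre, the jump k of f(x, .) at p, and the modulus delta
  of equicontinuity at x. Localising all coordinates of p and x leaves at most one p in every
  fibre, and on a smaller box f(x0, p) is nearly constant, while x0 is so close to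
  every x involved that f(x, .) cannot jump by k.
*)
theory Submission
  imports Defs
begin

section \<open>Definable predicates\<close>

text \<open>Equicontinuity makes discontinuity a matter of \<open>p\<close> alone: where
  \<open>f\<close> is discontinuous at \<open>(x, p)\<close>, already \<open>f (x, _)\<close> jumps
  at \<open>p\<close>. The obstacle is that \<open>x\<close> changes with \<open>p\<close>, and that
  the points \<open>p'\<close> witnessing the jump generally lie over other base points and need not
  have the properties collected for \<open>p\<close>. Isolation repairs the second defect: over the
  projection of \<open>p'\<close> there is a point with all these properties, close to
  \<open>p'\<close>, hence equal to it. A single comparison point \<open>x0\<close> repairs the
  first. No witness is ever selected definably. The relations stay multivalued, and each step passes
  to a smaller box and to fewer witnesses. Since the jump has a fixed size \<open>k\<close>,
  constancy up to an error is enough, and continuity of definable functions is never established.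
  Four comparisons, from \<open>f (x, p')\<close> through \<open>f (x0, p')\<close>, a constant and
  \<open>f (x0, p)\<close> to \<open>f (x, p)\<close>, cost four errors, so these are chosen with
  fourfold sum below \<open>k\<close>.\<close>

primrec ren_trm :: "(nat \<Rightarrow> nat) \<Rightarrow> 'f trm \<Rightarrow> 'f trm" where
  "ren_trm \<pi> (Var i) = Var (\<pi> i)"
| "ren_trm \<pi> Zero = Zero"
| "ren_trm \<pi> (Add s t) = Add (ren_trm \<pi> s) (ren_trm \<pi> t)"
| "ren_trm \<pi> (App g ts) = App g (map (ren_trm \<pi>) ts)"

primrec ren_fm :: "(nat \<Rightarrow> nat) \<Rightarrow> ('f, 'r) fm \<Rightarrow> ('f, 'r) fm" where
  "ren_fm \<pi> (Eq s t) = Eq (ren_trm \<pi> s) (ren_trm \<pi> t)"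
| "ren_fm \<pi> (Less s t) = Less (ren_trm \<pi> s) (ren_trm \<pi> t)"
| "ren_fm \<pi> (Rel r ts) = Rel r (map (ren_trm \<pi>) ts)"
| "ren_fm \<pi> (Neg \<phi>) = Neg (ren_fm \<pi> \<phi>)"
| "ren_fm \<pi> (Conj \<phi> \<psi>) = Conj (ren_fm \<pi> \<phi>) (ren_fm \<pi> \<psi>)"
| "ren_fm \<pi> (Ex i \<phi>) = Ex (\<pi> i) (ren_fm \<pi> \<phi>)"

lemma trm_val_ren: "trm_val \<M> e (ren_trm \<pi> t) = trm_val \<M> (e \<circ> \<pi>) t"
  by (induction t) (auto simp: o_def cong: map_cong)

text \<open>Injectivity serves the quantifier case: an update of \<open>e\<close> at
  \<open>\<pi> i\<close> must change \<open>e \<circ> \<pi>\<close> at \<open>i\<close>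
  only.\<close>

lemma sat_ren:
  assumes "inj \<pi>"
  shows "sat \<M> e (ren_fm \<pi> \<phi>) \<longleftrightarrow> sat \<M> (e \<circ> \<pi>) \<phi>"
proof (induction \<phi> arbitrary: e)
  case (Ex i \<phi>)
  have "(e(\<pi> i := a)) \<circ> \<pi> = (e \<circ> \<pi>)(i := a)" for a
    using assms by (auto simp: inj_eq)
  then show ?case by (simp only: ren_fm.simps sat.simps Ex.IH)
qed (simp_all add: trm_val_ren o_def cong: map_cong)

text \<open>Any number above all variable indices will do, so sums replace maxima.\<close>

primrec trm_bound :: "'f trm \<Rightarrow> nat" where
  "trm_bound (Var i) = Suc i"
| "trm_bound Zero = 0"
| "trm_bound (Add s t) = trm_bound s + trm_bound t"
| "trm_bound (App g ts) = sum_list (map trm_bound ts)"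

primrec fm_bound :: "('f, 'r) fm \<Rightarrow> nat" where
  "fm_bound (Eq s t) = trm_bound s + trm_bound t"
| "fm_bound (Less s t) = trm_bound s + trm_bound t"
| "fm_bound (Rel r ts) = sum_list (map trm_bound ts)"
| "fm_bound (Neg \<phi>) = fm_bound \<phi>"
| "fm_bound (Conj \<phi> \<psi>) = fm_bound \<phi> + fm_bound \<psi>"
| "fm_bound (Ex i \<phi>) = fm_bound \<phi>"

lemma trm_bound_le_sum_list: "t \<in> set ts \<Longrightarrow> trm_bound t \<le> sum_list (map trm_bound ts)"
  by (rule member_le_sum_list) auto

lemma trm_val_cong:
  "(\<And>i. i < trm_bound t \<Longrightarrow> e i = e' i) \<Longrightarrow> trm_val \<M> e t = trm_val \<M> e' t"
proof (induction t)
  case (App g ts)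
  have "trm_val \<M> e t = trm_val \<M> e' t" if "t \<in> set ts" for t
  proof (rule App.IH[OF that])
    fix i assume "i < trm_bound t"
    then show "e i = e' i"
      using trm_bound_le_sum_list[OF that] App.prems by simp
  qed
  then have "map (trm_val \<M> e) ts = map (trm_val \<M> e') ts" by simp
  then show ?case by (metis trm_val.simps(4))
qed auto

text \<open>This finiteness reduces the replacement of infinitely many variables to the finite
  substitutions of \<open>sat_subst\<close>.\<close>

lemma sat_cong:
  "(\<And>i. i < fm_bound \<phi> \<Longrightarrow> e i = e' i) \<Longrightarrow> sat \<M> e \<phi> \<longleftrightarrow> sat \<M> e' \<phi>"
proof (induction \<phi> arbitrary: e e')
  case (Eq s t)
  have "trm_val \<M> e s = trm_val \<M> e' s" "trm_val \<M> e t = trm_val \<M> e' t"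
    by (rule trm_val_cong; use Eq in auto)+
  then show ?case by simp
next
  case (Less s t)
  have "trm_val \<M> e s = trm_val \<M> e' s" "trm_val \<M> e t = trm_val \<M> e' t"
    by (rule trm_val_cong; use Less in auto)+
  then show ?case by simp
next
  case (Rel r ts)
  have "trm_val \<M> e t = trm_val \<M> e' t" if "t \<in> set ts" for t
  proof (rule trm_val_cong)
    fix i assume "i < trm_bound t"
    then show "e i = e' i"
      using trm_bound_le_sum_list[OF that] Rel.prems by simp
  qed
  then have "map (trm_val \<M> e) ts = map (trm_val \<M> e') ts" by simp
  then show ?case by (metis sat.simps(3))
next
  case (Neg \<phi>)
  have "sat \<M> e \<phi> \<longleftrightarrow> sat \<M> e' \<phi>"
    by (rule Neg.IH) (use Neg.prems in auto)
  then show ?case by simp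
next
  case (Conj \<phi> \<psi>)
  have "sat \<M> e \<phi> \<longleftrightarrow> sat \<M> e' \<phi>" "sat \<M> e \<psi> \<longleftrightarrow> sat \<M> e' \<psi>"
    by (rule Conj.IH; use Conj.prems in auto)+
  then show ?case by simp
next
  case (Ex i \<phi>)
  have "sat \<M> (e(i := a)) \<phi> \<longleftrightarrow> sat \<M> (e'(i := a)) \<phi>" for a
    by (rule Ex.IH) (use Ex.prems in auto)
  then show ?case by simp
qed

text \<open>The formula \<open>\<exists>x\<^sub>k. x\<^sub>k = x\<^sub>j \<and> \<phi>\<close> substitutes \<open>x\<^sub>j\<close> for \<open>x\<^sub>k\<close> without any capture.\<close>

lemma sat_subst:
  fixes \<M> :: "('a::dense_linordered_ab_group, 'f, 'r) expansion"
  assumes "finite S" and "\<And>i. i \<in> S \<Longrightarrow> s i \<notin> S"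
  shows "\<exists>\<psi>. \<forall>e. sat \<M> e \<psi> \<longleftrightarrow> sat \<M> (\<lambda>i. if i \<in> S then e (s i) else e i) \<phi>"
  using assms
proof (induction S)
  case empty
  then show ?case by auto
next
  case (insert k S)
  then obtain \<psi> where \<psi>: "\<And>e. sat \<M> e \<psi> \<longleftrightarrow> sat \<M> (\<lambda>i. if i \<in> S then e (s i) else e i) \<phi>"
    by auto
  have eq: "(\<lambda>i. if i \<in> S then (e(k := e (s k))) (s i) else (e(k := e (s k))) i) =
      (\<lambda>i. if i \<in> insert k S then e (s i) else e i)" for e :: "nat \<Rightarrow> 'a"
    using insert by (auto simp: fun_eq_iff)
  have "sat \<M> e (Ex k (Conj (Eq (Var k) (Var (s k))) \<psi>)) \<longleftrightarrow>
      sat \<M> (\<lambda>i. if i \<in> insert k S then e (s i) else e i) \<phi>" for e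
  proof -
    have "s k \<noteq> k" using insert.prems by auto
    then have "sat \<M> e (Ex k (Conj (Eq (Var k) (Var (s k))) \<psi>)) \<longleftrightarrow> sat \<M> (e(k := e (s k))) \<psi>"
      by auto
    then show ?thesis by (simp only: \<psi> eq)
  qed
  then show ?case by blast
qed

section \<open>Closure properties of definable predicates with parameters\<close>

locale expansion =
  fixes \<M> :: "('a::dense_linordered_ab_group, 'f, 'r) expansion"
begin

text \<open>
  A formula variable stands for an entry \<open>Inl j\<close> of the argument or for a parameter \<open>Inr c\<close>.
  A predicate with this property depends on finitely many entries only.
\<close>

definition defpred :: "((nat \<Rightarrow> 'a) \<Rightarrow> bool) \<Rightarrow> bool" where
  "defpred Q \<longleftrightarrow> (\<exists>\<phi> \<tau>. \<forall>v. Q v \<longleftrightarrow> sat \<M> (\<lambda>i. case_sum v id (\<tau> i)) \<phi>)"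

text \<open>A term is any function with definable graph. The value is entry 0 and the arguments are
  shifted behind it, the same convention as for bound variables below.\<close>

definition deftrm :: "((nat \<Rightarrow> 'a) \<Rightarrow> 'a) \<Rightarrow> bool" where
  "deftrm t \<longleftrightarrow> defpred (\<lambda>v. v 0 = t (\<lambda>i. v (Suc i)))"

text \<open>The formula stays the same: the assignment \<open>\<tau>\<close> absorbs every
  \<open>\<sigma>\<close>, injective or not.\<close>

lemma defpred_reindex:
  assumes "defpred Q"
  shows "defpred (\<lambda>v. Q (\<lambda>i. v (\<sigma> i)))"
proof -
  obtain \<phi> \<tau> where Q: "\<And>v. Q v \<longleftrightarrow> sat \<M> (\<lambda>i. case_sum v id (\<tau> i)) \<phi>"
    using assms by (auto simp: defpred_def)
  have "case_sum (\<lambda>i. v (\<sigma> i)) id (\<tau> i) = case_sum v id (map_sum \<sigma> id (\<tau> i))" for v :: "nat \<Rightarrow> 'a" and i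
    by (cases "\<tau> i") auto
  then show ?thesis
    unfolding defpred_def Q by (intro exI[of _ \<phi>] exI[of _ "\<lambda>i. map_sum \<sigma> id (\<tau> i)"]) simp
qed

lemma defpred_fm:
  "defpred (\<lambda>v. sat \<M> v \<phi>)"
  unfolding defpred_def by (rule exI[of _ \<phi>], rule exI[of _ Inl]) simp

lemma defpred_const: "defpred (\<lambda>v. b)"
  using defpred_fm[of "if b then Eq Zero Zero else Less Zero Zero"] by (cases b) auto

lemma defpred_not:
  assumes "defpred Q"
  shows "defpred (\<lambda>v. \<not> Q v)"
proof -
  obtain \<phi> \<tau> where Q: "\<And>v. Q v \<longleftrightarrow> sat \<M> (\<lambda>i. case_sum v id (\<tau> i)) \<phi>"
    using assms by (auto simp: defpred_def)
  show ?thesis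
    unfolding defpred_def Q by (intro exI[of _ "Neg \<phi>"] exI[of _ \<tau>]) simp
qed

lemma defpred_conj:
  assumes "defpred Q" "defpred R"
  shows "defpred (\<lambda>v. Q v \<and> R v)"
proof -
  obtain \<phi> \<tau> where Q: "\<And>v. Q v \<longleftrightarrow> sat \<M> (\<lambda>i. case_sum v id (\<tau> i)) \<phi>"
    using assms by (auto simp: defpred_def)
  obtain \<psi> \<tau>' where R: "\<And>v. R v \<longleftrightarrow> sat \<M> (\<lambda>i. case_sum v id (\<tau>' i)) \<psi>"
    using assms by (auto simp: defpred_def)
  \<comment> \<open>The two formulas may use one variable for different entries. Moving them to even
    and odd variables separates them.\<close>
  define \<rho> where "\<rho> i = (if even i then \<tau> (i div 2) else \<tau>' (i div 2))" for i
  have "inj (\<lambda>i::nat. 2 * i)" "inj (\<lambda>i::nat. Suc (2 * i))"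
    by (auto simp: inj_def)
  then have "(Q v \<and> R v) \<longleftrightarrow> sat \<M> (\<lambda>i. case_sum v id (\<rho> i))
      (Conj (ren_fm (\<lambda>i. 2 * i) \<phi>) (ren_fm (\<lambda>i. Suc (2 * i)) \<psi>))" for v
    by (simp add: sat_ren o_def \<rho>_def Q R)
  then show ?thesis unfolding defpred_def by blast
qed

lemma defpred_disj:
  assumes "defpred Q" "defpred R"
  shows "defpred (\<lambda>v. Q v \<or> R v)"
  using defpred_not[OF defpred_conj[OF assms[THEN defpred_not]]] by simp

lemma defpred_imp:
  assumes "defpred Q" "defpred R"
  shows "defpred (\<lambda>v. Q v \<longrightarrow> R v)"
  unfolding imp_conv_disj by (intro defpred_disj defpred_not assms)

lemma defpred_ex:
  assumes "defpred (\<lambda>v. B (v 0) (\<lambda>i. v (Suc i)))"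
  shows "defpred (\<lambda>v. \<exists>a. B a v)"
proof -
  obtain \<phi> \<tau> where B0:
    "\<And>v. B (v 0) (\<lambda>i. v (Suc i)) \<longleftrightarrow> sat \<M> (\<lambda>i. case_sum v id (\<tau> i)) \<phi>"
    using assms[unfolded defpred_def] by (elim exE) (rule that, erule spec)
  have B: "B a v \<longleftrightarrow> sat \<M> (\<lambda>i. case_sum (case_nat a v) id (\<tau> i)) \<phi>" for a v
    using B0[of "case_nat a v"] by simp
  \<comment> \<open>Several variables of \<open>\<phi>\<close> may stand for entry 0. Renaming by
    \<open>Suc\<close> frees variable 0, which then replaces all of them, so that a single
    \<open>Ex 0\<close> binds them.\<close>
  define S where "S = Suc ` {i. i < fm_bound \<phi> \<and> \<tau> i = Inl 0}"
  have "\<exists>\<psi>. \<forall>e. sat \<M> e \<psi> \<longleftrightarrow>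
      sat \<M> (\<lambda>i. if i \<in> S then e ((\<lambda>_. 0) i) else e i) (ren_fm Suc \<phi>)"
    by (rule sat_subst) (auto simp: S_def)
  then obtain \<psi> where \<psi>:
    "\<And>e. sat \<M> e \<psi> \<longleftrightarrow> sat \<M> (\<lambda>i. if i \<in> S then e 0 else e i) (ren_fm Suc \<phi>)"
    by auto
  \<comment> \<open>Each \<open>Inr 0\<close> is a dummy: it is overwritten by the quantifier,
    replaced by the substitution, or belongs to a variable beyond
    \<open>fm_bound \<phi>\<close>.\<close>
  define \<tau>' :: "nat \<Rightarrow> nat + 'a" where
    "\<tau>' k = (case k of 0 \<Rightarrow> Inr 0
      | Suc i \<Rightarrow> case_sum (\<lambda>j. case j of 0 \<Rightarrow> Inr 0 | Suc j \<Rightarrow> Inl j) Inr (\<tau> i))" for k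
  have "(\<exists>a. B a v) \<longleftrightarrow> sat \<M> (\<lambda>i. case_sum v id (\<tau>' i)) (Ex 0 \<psi>)" for v
  proof -
    have "B a v \<longleftrightarrow> sat \<M> ((\<lambda>i. case_sum v id (\<tau>' i))(0 := a)) \<psi>" for a
      unfolding B \<psi> sat_ren[OF inj_Suc]
    proof (rule sat_cong)
      fix i assume "i < fm_bound \<phi>"
      then show "case_sum (case_nat a v) id (\<tau> i) =
          ((\<lambda>i. if i \<in> S then ((\<lambda>i. case_sum v id (\<tau>' i))(0 := a)) 0
            else ((\<lambda>i. case_sum v id (\<tau>' i))(0 := a)) i) \<circ> Suc) i"
        by (auto simp: S_def \<tau>'_def split: sum.split nat.split)
    qed
    then show ?thesis by simp
  qed
  then show ?thesis unfolding defpred_def by blast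
qed

lemma defpred_all:
  assumes "defpred (\<lambda>v. B (v 0) (\<lambda>i. v (Suc i)))"
  shows "defpred (\<lambda>v. \<forall>a. B a v)"
  using defpred_not[OF defpred_ex[of "\<lambda>a v. \<not> B a v", OF defpred_not[OF assms]]] by simp

lemma cart_Suc_ex: "(\<exists>p\<in>cart (Suc n). Q p) \<longleftrightarrow> (\<exists>a. \<exists>p\<in>cart n. Q (p(n := a)))"
proof
  assume "\<exists>p\<in>cart (Suc n). Q p"
  then obtain p where p: "p \<in> cart (Suc n)" "Q p" by blast
  have "(p(n := undefined))(n := p n) = p" by simp
  moreover have "p(n := undefined) \<in> cart n"
    using p(1) by (auto simp: PiE_def extensional_def)
  ultimately show "\<exists>a. \<exists>p\<in>cart n. Q (p(n := a))" using p(2) by metis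
next
  assume "\<exists>a. \<exists>p\<in>cart n. Q (p(n := a))"
  then show "\<exists>p\<in>cart (Suc n). Q p"
    by (elim exE bexE) (rule bexI, assumption, auto simp: PiE_def extensional_def)
qed

lemma defpred_ex_cart:
  assumes "defpred (\<lambda>v. B (\<lambda>i\<in>{..<n}. v i) (\<lambda>i. v (n + i)))"
  shows "defpred (\<lambda>v. \<exists>p\<in>cart n. B p v)"
  using assms
proof (induction n arbitrary: B)
  case 0
  have "(\<lambda>i\<in>{..<0}. v i) = (\<lambda>_. undefined)" for v :: "nat \<Rightarrow> 'a" by auto
  with 0 show ?case by simp
next
  case (Suc n)
  have eq: "(\<lambda>i\<in>{..<n}. v i)(n := v (n + 0)) = (\<lambda>i\<in>{..<Suc n}. v i)" for v :: "nat \<Rightarrow> 'a"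
    by (auto simp: fun_eq_iff)
  \<comment> \<open>The last coordinate is quantified outermost. It heads the context of the other
    \<open>n\<close> coordinates, so it becomes entry \<open>n\<close> once they are placed in
    front.\<close>
  have "defpred (\<lambda>v. \<exists>p\<in>cart n. B (p(n := v 0)) (\<lambda>i. v (Suc i)))"
    by (rule Suc.IH) (use Suc.prems in \<open>simp only: eq add_Suc add_Suc_right\<close>)
  then show ?case unfolding cart_Suc_ex by (rule defpred_ex)
qed

lemma defpred_all_cart:
  assumes "defpred (\<lambda>v. B (\<lambda>i\<in>{..<n}. v i) (\<lambda>i. v (n + i)))"
  shows "defpred (\<lambda>v. \<forall>p\<in>cart n. B p v)"
  using defpred_not[OF defpred_ex_cart[of "\<lambda>p v. \<not> B p v", OF defpred_not[OF assms]]] by simp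

lemma defpred_all_less:
  fixes n :: nat
  assumes "\<And>i. i < n \<Longrightarrow> defpred (Q i)"
  shows "defpred (\<lambda>v. \<forall>i<n. Q i v)"
  using assms
proof (induction n)
  case 0
  then show ?case by (simp add: defpred_const)
next
  case (Suc n)
  have "(\<forall>i<Suc n. Q i v) \<longleftrightarrow> (\<forall>i<n. Q i v) \<and> Q n v" for v
    using less_Suc_eq by auto
  moreover have "defpred (\<lambda>v. (\<forall>i<n. Q i v) \<and> Q n v)"
    by (rule defpred_conj) (use Suc in auto)
  ultimately show ?case by simp
qed

text \<open>\<open>Q\<close> looks at finitely many entries only, so a point of some power of
  \<open>M\<close> can hold the values of the relevant terms and be quantified
  existentially.\<close>

lemma defpred_subst:
  assumes "defpred Q" and t: "\<And>i. deftrm (t i)"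
  shows "defpred (\<lambda>v. Q (\<lambda>i. t i v))"
proof -
  obtain \<phi> \<tau> where Q: "\<And>v. Q v \<longleftrightarrow> sat \<M> (\<lambda>i. case_sum v id (\<tau> i)) \<phi>"
    using assms by (auto simp: defpred_def)
  \<comment> \<open>One more than the sum of all entry indices that occur exceeds each of
    them.\<close>
  define N where "N = Suc (\<Sum>i<fm_bound \<phi>. case_sum id (\<lambda>_. 0) (\<tau> i))"
  have Q_cong: "Q v \<longleftrightarrow> Q w" if "\<And>i. i < N \<Longrightarrow> v i = w i" for v w
    unfolding Q
  proof (rule sat_cong)
    fix i assume "i < fm_bound \<phi>"
    then have "case_sum id (\<lambda>_. 0) (\<tau> i) < N"
      unfolding N_def by (intro le_imp_less_Suc member_le_sum) auto
    then show "case_sum v id (\<tau> i) = case_sum w id (\<tau> i)"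
      using that by (auto split: sum.splits)
  qed
  have "defpred (\<lambda>v. (\<forall>i<N. (\<lambda>i\<in>{..<N}. v i) i = t i (\<lambda>j. v (N + j))) \<and> Q (\<lambda>i\<in>{..<N}. v i))"
  proof (intro defpred_conj defpred_all_less)
    fix i assume "i < N"
    have "defpred (\<lambda>v. v i = t i (\<lambda>j. v (N + j)))"
      using defpred_reindex[OF t[of i, unfolded deftrm_def], of "case_nat i (\<lambda>j. N + j)"] by simp
    with \<open>i < N\<close> show "defpred (\<lambda>v. (\<lambda>i\<in>{..<N}. v i) i = t i (\<lambda>j. v (N + j)))" by simp
  next
    have "Q (\<lambda>i\<in>{..<N}. v i) \<longleftrightarrow> Q v" for v by (rule Q_cong) simp
    with assms(1) show "defpred (\<lambda>v. Q (\<lambda>i\<in>{..<N}. v i))" by simp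
  qed
  then have "defpred (\<lambda>v. \<exists>p\<in>cart N. (\<forall>i<N. p i = t i v) \<and> Q p)"
    by (rule defpred_ex_cart)
  moreover have "(\<exists>p\<in>cart N. (\<forall>i<N. p i = t i v) \<and> Q p) \<longleftrightarrow> Q (\<lambda>i. t i v)" for v
  proof
    assume "\<exists>p\<in>cart N. (\<forall>i<N. p i = t i v) \<and> Q p"
    then obtain p where p: "\<forall>i<N. p i = t i v" "Q p" by blast
    have "Q p \<longleftrightarrow> Q (\<lambda>i. t i v)" by (rule Q_cong) (use p(1) in simp)
    with p(2) show "Q (\<lambda>i. t i v)" by simp
  next
    assume "Q (\<lambda>i. t i v)"
    then have "Q (\<lambda>i\<in>{..<N}. t i v)"
      using Q_cong[of "\<lambda>i\<in>{..<N}. t i v" "\<lambda>i. t i v"] by auto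
    then show "\<exists>p\<in>cart N. (\<forall>i<N. p i = t i v) \<and> Q p"
      by (intro bexI[of _ "\<lambda>i\<in>{..<N}. t i v"]) auto
  qed
  ultimately show ?thesis by simp
qed

lemma deftrm_var: "deftrm (\<lambda>v. v i)"
  unfolding deftrm_def using defpred_fm[of "Eq (Var 0) (Var (Suc i))"] by simp

lemma deftrm_const: "deftrm (\<lambda>v. c)"
  unfolding deftrm_def defpred_def
  by (intro exI[of _ "Eq (Var 0) (Var 1)"] exI[of _ "\<lambda>i. if i = 0 then Inl 0 else Inr c"]) simp

lemma deftrm_shift: "deftrm t \<Longrightarrow> deftrm (\<lambda>v. t (\<lambda>i. v (\<sigma> i)))"
  unfolding deftrm_def
  using defpred_reindex[of "\<lambda>v. v 0 = t (\<lambda>i. v (Suc i))" "case_nat 0 (\<lambda>i. Suc (\<sigma> i))"] by simp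

lemma defpred_bin:
  assumes "defpred (\<lambda>v. R (v 0) (v 1))" "deftrm s" "deftrm t"
  shows "defpred (\<lambda>v. R (s v) (t v))"
  using defpred_subst[OF assms(1), of "\<lambda>i. if i = 0 then s else t"] assms(2,3)
  by (auto split: if_splits)

lemma defpred_eq: "deftrm s \<Longrightarrow> deftrm t \<Longrightarrow> defpred (\<lambda>v. s v = t v)"
  by (rule defpred_bin) (use defpred_fm[of "Eq (Var 0) (Var 1)"] in simp_all)

lemma defpred_less: "deftrm s \<Longrightarrow> deftrm t \<Longrightarrow> defpred (\<lambda>v. s v < t v)"
  by (rule defpred_bin) (use defpred_fm[of "Less (Var 0) (Var 1)"] in simp_all)

lemma defpred_le: "deftrm s \<Longrightarrow> deftrm t \<Longrightarrow> defpred (\<lambda>v. s v \<le> t v)"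
  using defpred_not[OF defpred_less[of t s]] by (simp add: not_less)

lemma deftrm_plus:
  assumes "deftrm s" "deftrm t"
  shows "deftrm (\<lambda>v. s v + t v)"
proof -
  let ?u = "case_nat (\<lambda>v. v 0) (case_nat (\<lambda>v. s (\<lambda>i. v (Suc i))) (\<lambda>_ v. t (\<lambda>i. v (Suc i))))"
  have "defpred (\<lambda>v. v 0 = v (Suc 0) + v (Suc (Suc 0)))"
    using defpred_fm[of "Eq (Var 0) (Add (Var (Suc 0)) (Var (Suc (Suc 0))))"] by simp
  moreover have "deftrm (?u i)" for i
    by (auto split: nat.split intro: deftrm_var assms[THEN deftrm_shift])
  ultimately have "defpred (\<lambda>v. (\<lambda>i. ?u i v) 0 = (\<lambda>i. ?u i v) (Suc 0) + (\<lambda>i. ?u i v) (Suc (Suc 0)))"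
    by (rule defpred_subst)
  then have "defpred (\<lambda>v. v 0 = s (\<lambda>i. v (Suc i)) + t (\<lambda>i. v (Suc i)))"
    by simp
  then show ?thesis by (simp only: deftrm_def)
qed

text \<open>Subtraction is not a symbol of the language, but the graph condition
  \<open>a = s - t\<close> reads \<open>a + t = s\<close>.\<close>

lemma deftrm_minus:
  assumes "deftrm s" "deftrm t"
  shows "deftrm (\<lambda>v. s v - t v)"
proof -
  have "defpred (\<lambda>v. v 0 + t (\<lambda>i. v (Suc i)) = s (\<lambda>i. v (Suc i)))"
    by (intro defpred_eq deftrm_plus deftrm_var assms[THEN deftrm_shift])
  then show ?thesis by (simp only: deftrm_def eq_diff_eq)
qed

lemma deftrm_abs:
  assumes "deftrm s"
  shows "deftrm (\<lambda>v. \<bar>s v\<bar>)"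
proof -
  have "defpred (\<lambda>v. (0 \<le> s (\<lambda>i. v (Suc i)) \<and> v 0 = s (\<lambda>i. v (Suc i))) \<or>
      (s (\<lambda>i. v (Suc i)) < 0 \<and> v 0 = 0 - s (\<lambda>i. v (Suc i))))"
    by (intro defpred_disj defpred_conj defpred_eq defpred_le defpred_less deftrm_minus deftrm_var
        deftrm_const assms[THEN deftrm_shift])
  moreover have "a = \<bar>b\<bar> \<longleftrightarrow> (0 \<le> b \<and> a = b) \<or> (b < 0 \<and> a = 0 - b)" for a b :: 'a
    by (cases "0 \<le> b") (auto simp: abs_of_neg)
  ultimately show ?thesis unfolding deftrm_def by simp
qed

lemma deftrm_if: "deftrm s \<Longrightarrow> deftrm t \<Longrightarrow> deftrm (\<lambda>v. if b then s v else t v)"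
  by (cases b) auto

lemma deftrm_upd:
  "deftrm s \<Longrightarrow> deftrm (\<lambda>v. g v i) \<Longrightarrow> deftrm (\<lambda>v. ((g v)(n := s v)) i)"
  by (cases "i = n") auto

lemma deftrm_restrict:
  "deftrm (\<lambda>v. g v i) \<Longrightarrow> deftrm (\<lambda>v. restrict (g v) A i)"
  by (cases "i \<in> A") (auto simp: deftrm_const)

lemmas defpred_intros =
  defpred_const defpred_not defpred_conj defpred_disj defpred_imp defpred_ex defpred_all
  defpred_ex_cart defpred_all_cart defpred_all_less defpred_eq defpred_less defpred_le
  deftrm_const deftrm_var deftrm_plus deftrm_minus deftrm_abs deftrm_if deftrm_upd deftrm_restrict

lemma definable_imp_defpred:
  assumes "definable \<M> n X" and "\<And>i. deftrm (t i)"
  shows "defpred (\<lambda>v. (\<lambda>i\<in>{..<n}. t i v) \<in> X)"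
proof -
  obtain \<phi> e where X: "X = {x \<in> cart n. sat \<M> (override_on e x {..<n}) \<phi>}"
    using assms(1) by (auto simp: definable_def)
  have "defpred (\<lambda>v. restrict v {..<n} \<in> X)"
    unfolding defpred_def
  proof (intro exI[of _ \<phi>] exI[of _ "\<lambda>i. if i < n then Inl i else Inr (e i)"] allI)
    fix v :: "nat \<Rightarrow> 'a"
    have "override_on e (restrict v {..<n}) {..<n} =
        (\<lambda>i. case_sum v id (if i < n then Inl i else Inr (e i)))"
      by (auto simp: override_on_def fun_eq_iff)
    then show "(restrict v {..<n} \<in> X) \<longleftrightarrow>
        sat \<M> (\<lambda>i. case_sum v id (if i < n then Inl i else Inr (e i))) \<phi>"
      by (simp add: X)
  qed
  from defpred_subst[OF this, of t, OF assms(2)] show ?thesis by simp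
qed

text \<open>In \<open>definable\<close>, variable \<open>j < n\<close> must be coordinate
  \<open>j\<close>, whereas \<open>\<tau>\<close> assigns roles freely. Renaming by
  \<open>n + i\<close> vacates the first \<open>n\<close> variables, which are then substituted
  where \<open>\<tau>\<close> asks for a coordinate.\<close>

lemma defpred_imp_definable:
  assumes "defpred Q"
  shows "definable \<M> n {x \<in> cart n. Q x}"
proof -
  obtain \<phi> \<tau> where Q: "\<And>v. Q v \<longleftrightarrow> sat \<M> (\<lambda>i. case_sum v id (\<tau> i)) \<phi>"
    using assms by (auto simp: defpred_def)
  define T where "T = {i. i < fm_bound \<phi> \<and> (\<exists>j<n. \<tau> i = Inl j)}"
  define s where "s k = projl (\<tau> (k - n))" for k
  have "finite ((\<lambda>i. n + i) ` T)" "\<And>k. k \<in> (\<lambda>i. n + i) ` T \<Longrightarrow> s k \<notin> (\<lambda>i. n + i) ` T"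
    by (auto simp: T_def s_def)
  from sat_subst[where s = s, OF this, where \<M> = \<M> and \<phi> = "ren_fm (\<lambda>i. n + i) \<phi>"] obtain \<psi> where \<psi>:
    "\<And>e. sat \<M> e \<psi> \<longleftrightarrow> sat \<M> (\<lambda>k. if k \<in> (\<lambda>i. n + i) ` T then e (s k) else e k)
      (ren_fm (\<lambda>i. n + i) \<phi>)"
    by blast
  \<comment> \<open>Points of \<open>cart n\<close> are \<open>undefined\<close> from index
    \<open>n\<close> on, so such entries turn into parameters with that value.\<close>
  define e where "e k = case_sum (\<lambda>_. undefined) id (\<tau> (k - n))" for k
  have "Q x \<longleftrightarrow> sat \<M> (override_on e x {..<n}) \<psi>" if "x \<in> cart n" for x
    unfolding Q \<psi> sat_ren[of "\<lambda>i. n + i", simplified]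
  proof (rule sat_cong)
    fix i assume "i < fm_bound \<phi>"
    then show "case_sum x id (\<tau> i) =
      ((\<lambda>k. if k \<in> (\<lambda>i. n + i) ` T then override_on e x {..<n} (s k)
        else override_on e x {..<n} k) \<circ> (\<lambda>i. n + i)) i"
      using that
      by (cases "\<tau> i") (auto simp: T_def s_def e_def override_on_def PiE_def extensional_def image_iff)
  qed
  then show ?thesis unfolding definable_def by blast
qed

end

section \<open>One variable\<close>

lemma abs_le_iff_ab_group:
  fixes x :: "'a::dense_linordered_ab_group"
  shows "\<bar>x\<bar> \<le> h \<longleftrightarrow> x \<le> h \<and> - x \<le> h"
  by (cases "0 \<le> x") (auto simp: abs_of_neg not_le
      intro: order_trans[of "- x" x h] order_trans[of x 0 h] order_trans[of x "- x"])

lemma abs_less_iff_ab_group: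
  fixes x :: "'a::dense_linordered_ab_group"
  shows "\<bar>x\<bar> < h \<longleftrightarrow> x < h \<and> - x < h"
  by (cases "0 \<le> x") (auto simp: abs_of_neg not_le
      intro: order_le_less_trans[of "- x" x h] order_le_less_trans[of x "- x"])

lemma abs_diff_less_iff':
  fixes x :: "'a::dense_linordered_ab_group"
  shows "\<bar>x - c\<bar> < h \<longleftrightarrow> c - h < x \<and> x < c + h"
  unfolding abs_less_iff_ab_group by (auto simp: diff_less_eq add.commute)

lemma abs_diff_le_iff':
  fixes x :: "'a::dense_linordered_ab_group"
  shows "\<bar>x - c\<bar> \<le> h \<longleftrightarrow> c - h \<le> x \<and> x \<le> c + h"
  unfolding abs_le_iff_ab_group by (auto simp: diff_le_eq add.commute)

lemma abs_diff_triangle: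
  fixes x :: "'a::dense_linordered_ab_group"
  shows "\<bar>x - z\<bar> \<le> \<bar>x - y\<bar> + \<bar>y - z\<bar>"
  using abs_triangle_ineq[of "x - y" "y - z"] by simp

text \<open>The group need not be divisible, so this replaces halving: an element below both
  \<open>y\<close> and \<open>\<epsilon> - y\<close> works.\<close>

lemma ex_add_self_less:
  fixes \<epsilon> :: "'a::dense_linordered_ab_group"
  assumes "0 < \<epsilon>"
  shows "\<exists>\<eta>>0. \<eta> + \<eta> < \<epsilon>"
proof -
  obtain y where y: "0 < y" "y < \<epsilon>" using dense[OF assms] by blast
  then obtain z where z: "0 < z" "z < min y (\<epsilon> - y)" using dense[of 0 "min y (\<epsilon> - y)"] by auto
  then have "z + z < y + (\<epsilon> - y)" by (intro add_strict_mono) auto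
  with z show ?thesis by auto
qed

definition has_interval :: "('a::linorder \<Rightarrow> bool) \<Rightarrow> bool" where
  "has_interval X \<longleftrightarrow> (\<exists>a b. a < b \<and> (\<forall>x. a < x \<and> x < b \<longrightarrow> X x))"

text \<open>A pure order condition, hence itself definable in families. For \<open>n = 0\<close> the
  box is the only point of \<open>cart 0\<close>, which starts the inductions.\<close>

definition has_box :: "nat \<Rightarrow> ((nat \<Rightarrow> 'a::linorder) \<Rightarrow> bool) \<Rightarrow> bool" where
  "has_box n X \<longleftrightarrow> (\<exists>l u. (\<forall>i<n. l i < u i) \<and>
    (\<forall>w\<in>cart n. (\<forall>i<n. l i < w i \<and> w i < u i) \<longrightarrow> X w))"

lemma has_interval_mono: "has_interval X \<Longrightarrow> (\<And>x. X x \<Longrightarrow> Y x) \<Longrightarrow> has_interval Y"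
  unfolding has_interval_def by blast

lemma has_box_mono: "has_box n X \<Longrightarrow> (\<And>w. w \<in> cart n \<Longrightarrow> X w \<Longrightarrow> Y w) \<Longrightarrow> has_box n Y"
  unfolding has_box_def by (elim exE) (rule exI, rule exI, auto)

text \<open>Midpoints may not exist; any inner point serves as centre, with the smaller distance to
  the endpoints as radius.\<close>

lemma has_intervalE:
  fixes X :: "'a::dense_linordered_ab_group \<Rightarrow> bool"
  assumes "has_interval X"
  obtains c h where "0 < h" "\<And>x. \<bar>x - c\<bar> < h \<Longrightarrow> X x"
proof -
  obtain a b where ab: "a < b" "\<And>x. a < x \<and> x < b \<Longrightarrow> X x"
    using assms by (auto simp: has_interval_def)
  obtain c where c: "a < c" "c < b" using dense[OF ab(1)] by blast
  show ?thesis
  proof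
    show "0 < min (c - a) (b - c)" using c by simp
    fix x assume "\<bar>x - c\<bar> < min (c - a) (b - c)"
    then have "\<bar>x - c\<bar> < c - a" "\<bar>x - c\<bar> < b - c" by auto
    then show "X x" by (intro ab(2)) (auto simp: abs_diff_less_iff')
  qed
qed

text \<open>The class admits the one-point group, where no interval has two endpoints. A positive
  element makes the order unbounded on both sides.\<close>

locale dculoas = expansion \<M>
  for \<M> :: "('a::dense_linordered_ab_group, 'f, 'r) expansion" +
  assumes DCULOAS: "DCULOAS \<M>"
    and nontrivial: "\<exists>e::'a. 0 < e"
begin

lemma ex_greater: "\<exists>b::'a. a < b"
proof -
  obtain e :: 'a where "0 < e" using nontrivial by blast
  then have "a < a + e" by simp
  then show ?thesis by blast
qed

lemma ex_smaller: "\<exists>b::'a. b < a"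
proof -
  obtain e :: 'a where "0 < e" using nontrivial by blast
  then have "a - e < a" by simp
  then show ?thesis by blast
qed

lemma defpred_un: "defpred (\<lambda>v. X (v 0)) \<Longrightarrow> deftrm s \<Longrightarrow> defpred (\<lambda>v. X (s v))"
  by (rule defpred_bin[of "\<lambda>x _. X x"])

text \<open>The three shifts make room for the bound variables: \<open>x\<close> is entry 0, and the
  two endpoints come next.\<close>

lemma defpred_has_interval:
  assumes "defpred (\<lambda>v. B (v 0) (\<lambda>i. v (Suc (Suc (Suc i)))))"
  shows "defpred (\<lambda>v. has_interval (\<lambda>x. B x v))"
  unfolding has_interval_def
  by (intro defpred_intros assms)

section \<open>One-sided germs of definable sets\<close>

lemma open_interval_inner:
  assumes "open_interval I" "(a::'a) \<in> I"
  shows "\<exists>l u. l < a \<and> a < u \<and> (\<forall>x. l < x \<and> x < u \<longrightarrow> x \<in> I)"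
proof -
  obtain L U where I: "I = {a. L < Fin a \<and> Fin a < U}"
    using assms by (auto simp: open_interval_def)
  obtain l where l: "l < a" "\<And>x. l < x \<Longrightarrow> L < Fin x"
  proof (cases L)
    case (Fin l)
    show ?thesis by (rule that[of l]) (use assms Fin I in auto)
  next
    case Minf
    show ?thesis using ex_smaller[of a] that Minf by auto
  qed (use assms I in auto)
  obtain u where u: "a < u" "\<And>x. x < u \<Longrightarrow> Fin x < U"
  proof (cases U)
    case (Fin u)
    show ?thesis by (rule that[of u]) (use assms Fin I in auto)
  next
    case Pinf
    show ?thesis using ex_greater[of a] that Pinf by auto
  qed (use assms I in auto)
  show ?thesis using l u by (auto simp: I)
qed

text \<open>The right germ of \<open>Y\<close> at \<open>a\<close> is full or empty. This property
  passes to finite unions, so it extracts from local o-minimality exactly a dichotomy on each side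
  of a point.\<close>

definition right_const :: "'a \<Rightarrow> 'a set \<Rightarrow> bool" where
  "right_const a Y \<longleftrightarrow>
    (\<exists>b>a. (\<forall>x. a < x \<and> x < b \<longrightarrow> x \<in> Y) \<or> (\<forall>x. a < x \<and> x < b \<longrightarrow> x \<notin> Y))"

lemma right_const_empty: "right_const a {}"
  using ex_greater[of a] by (auto simp: right_const_def)

lemma right_const_Un:
  assumes "right_const a Y" "right_const a Z"
  shows "right_const a (Y \<union> Z)"
proof -
  obtain b where b: "b > a" "(\<forall>x. a < x \<and> x < b \<longrightarrow> x \<in> Y) \<or> (\<forall>x. a < x \<and> x < b \<longrightarrow> x \<notin> Y)"
    using assms(1) by (auto simp: right_const_def)
  obtain c where c: "c > a" "(\<forall>x. a < x \<and> x < c \<longrightarrow> x \<in> Z) \<or> (\<forall>x. a < x \<and> x < c \<longrightarrow> x \<notin> Z)"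
    using assms(2) by (auto simp: right_const_def)
  show ?thesis
    unfolding right_const_def by (rule exI[of _ "min b c"]) (use b c in auto)
qed

lemma right_const_singleton: "right_const a {c}"
proof (cases "a < c")
  case True
  then show ?thesis unfolding right_const_def by (intro exI[of _ c]) auto
next
  case False
  obtain b where "a < b" using ex_greater by blast
  with False show ?thesis unfolding right_const_def by (intro exI[of _ b]) auto
qed

lemma right_const_open_interval:
  assumes "open_interval J"
  shows "right_const a J"
proof -
  obtain L U where J: "J = {a. L < Fin a \<and> Fin a < U}"
    using assms by (auto simp: open_interval_def)
  obtain e where e: "a < e" using ex_greater by blast
  have L: "right_const a {x. L < Fin x}"
  proof (cases L)
    case (Fin l)
    show ?thesis
    proof (cases "a < l")
      case True
      then show ?thesis unfolding right_const_def by (intro exI[of _ l]) (auto simp: Fin)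
    next
      case False
      then show ?thesis unfolding right_const_def by (intro exI[of _ e]) (use e in \<open>auto simp: Fin\<close>)
    qed
  qed (use e in \<open>auto simp: right_const_def\<close>)
  have U: "right_const a {x. Fin x < U}"
  proof (cases U)
    case (Fin u)
    show ?thesis
    proof (cases "a < u")
      case True
      then show ?thesis unfolding right_const_def by (intro exI[of _ u]) (auto simp: Fin)
    next
      case False
      then show ?thesis unfolding right_const_def by (intro exI[of _ e]) (use e in \<open>auto simp: Fin\<close>)
    qed
  qed (use e in \<open>auto simp: right_const_def\<close>)
  obtain b where b: "b > a" "(\<forall>x. a < x \<and> x < b \<longrightarrow> L < Fin x) \<or> (\<forall>x. a < x \<and> x < b \<longrightarrow> \<not> L < Fin x)"
    using L by (auto simp: right_const_def)
  obtain c where c: "c > a" "(\<forall>x. a < x \<and> x < c \<longrightarrow> Fin x < U) \<or> (\<forall>x. a < x \<and> x < c \<longrightarrow> \<not> Fin x < U)"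
    using U by (auto simp: right_const_def)
  show ?thesis
    unfolding right_const_def J by (rule exI[of _ "min b c"]) (use b c in auto)
qed

lemma right_const_fin_union:
  assumes "fin_union_points_intervals Y"
  shows "right_const a Y"
proof -
  obtain F \<J> where F: "finite F" and \<J>: "finite \<J>" "\<forall>J\<in>\<J>. open_interval J" and Y: "Y = F \<union> \<Union>\<J>"
    using assms by (auto simp: fin_union_points_intervals_def)
  have "right_const a F"
    using F
  proof (induction F)
    case (insert c F)
    then show ?case
      using right_const_Un[OF right_const_singleton[of a c] insert.IH] by simp
  qed (rule right_const_empty)
  moreover have "right_const a (\<Union>\<J>)"
    using \<J>
  proof (induction \<J>)
    case (insert J \<J>)
    then show ?case
      using right_const_Un[OF right_const_open_interval[of J a]] by simp
  qed (use right_const_empty in simp)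
  ultimately show ?thesis unfolding Y by (rule right_const_Un)
qed

lemma uniformly_locally_o_minimalE:
  assumes "definable \<M> (Suc n) X" "b \<in> cart n"
  obtains I B where "open_interval I" "a \<in> I" "open_box n B" "b \<in> B"
    "\<And>y. y \<in> B \<Longrightarrow> fin_union_points_intervals ({x. y(n := x) \<in> X} \<inter> I)"
  using DCULOAS assms unfolding DCULOAS_def unif_locally_o_minimal_2nd_def by meson

text \<open>The uniform axiom is applied to a family over the one-point space
  \<open>cart 0\<close>.\<close>

lemma right_o_minimal:
  assumes "defpred (\<lambda>v. X (v 0))"
  shows "\<exists>b>a. (\<forall>x. a < x \<and> x < b \<longrightarrow> X x) \<or> (\<forall>x. a < x \<and> x < b \<longrightarrow> \<not> X x)"
proof -
  have def: "definable \<M> (Suc 0) {x \<in> cart (Suc 0). X (x 0)}"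
    by (rule defpred_imp_definable[OF assms])
  have pt: "(\<lambda>_. undefined :: 'a) \<in> cart 0" by simp
  obtain I B where
    I: "open_interval I" "a \<in> I" and B: "(\<lambda>_. undefined) \<in> B"
    and fin: "\<And>y. y \<in> B \<Longrightarrow>
      fin_union_points_intervals ({x. y(0 := x) \<in> {x \<in> cart (Suc 0). X (x 0)}} \<inter> I)"
    by (rule uniformly_locally_o_minimalE[OF def pt, of a]) (rule that)
  have "{x. (\<lambda>_. undefined)(0 := x) \<in> {x \<in> cart (Suc 0). X (x 0)}} = {x. X x}"
    by (auto simp: PiE_def extensional_def)
  with fin[OF B] have "right_const a ({x. X x} \<inter> I)"
    by (simp add: right_const_fin_union)
  then obtain b where b: "b > a" "(\<forall>x. a < x \<and> x < b \<longrightarrow> x \<in> {x. X x} \<inter> I) \<or>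
      (\<forall>x. a < x \<and> x < b \<longrightarrow> x \<notin> {x. X x} \<inter> I)"
    unfolding right_const_def by blast
  obtain l u where lu: "l < a" "a < u" "\<forall>x. l < x \<and> x < u \<longrightarrow> x \<in> I"
    using open_interval_inner[OF I(1,2)] by blast
  show ?thesis
    by (rule exI[of _ "min b u"]) (use b lu in auto)
qed

text \<open>Reflection \<open>x \<mapsto> - x\<close> exchanges the two sides.\<close>

lemma left_o_minimal:
  assumes "defpred (\<lambda>v. X (v 0))"
  shows "\<exists>b<a. (\<forall>x. b < x \<and> x < a \<longrightarrow> X x) \<or> (\<forall>x. b < x \<and> x < a \<longrightarrow> \<not> X x)"
proof -
  have "defpred (\<lambda>v. X (0 - v 0))"
    by (rule defpred_un[OF assms]) (intro defpred_intros)
  from right_o_minimal[OF this, of "- a"] obtain b where b: "- a < b"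
    "(\<forall>x. - a < x \<and> x < b \<longrightarrow> X (0 - x)) \<or> (\<forall>x. - a < x \<and> x < b \<longrightarrow> \<not> X (0 - x))" by blast
  have "X x \<longleftrightarrow> X (0 - (- x))" "- b < x \<and> x < a \<longleftrightarrow> - a < - x \<and> - x < b" for x
    by (auto simp: minus_less_iff)
  then have "(\<forall>x. - b < x \<and> x < a \<longrightarrow> X x) \<or> (\<forall>x. - b < x \<and> x < a \<longrightarrow> \<not> X x)"
    using b(2) by metis
  moreover have "- b < a" using b(1) by (simp add: minus_less_iff)
  ultimately show ?thesis by blast
qed

text \<open>A full germ on either side would be an interval in \<open>X\<close>. Thus a definable
  set without intervals is closed and discrete.\<close>

lemma punctured_nbhd_avoids:
  assumes "defpred (\<lambda>v. X (v 0))" "\<not> has_interval X"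
  shows "\<exists>k>0. \<forall>x. 0 < \<bar>x - a\<bar> \<and> \<bar>x - a\<bar> < k \<longrightarrow> \<not> X x"
proof -
  obtain b where b: "a < b" "\<forall>x. a < x \<and> x < b \<longrightarrow> \<not> X x"
    using right_o_minimal[OF assms(1), of a] assms(2) unfolding has_interval_def by blast
  obtain c where c: "c < a" "\<forall>x. c < x \<and> x < a \<longrightarrow> \<not> X x"
    using left_o_minimal[OF assms(1), of a] assms(2) unfolding has_interval_def by blast
  show ?thesis
  proof (intro exI[of _ "min (b - a) (a - c)"] conjI allI impI)
    show "0 < min (b - a) (a - c)" using b c by simp
    fix x assume x: "0 < \<bar>x - a\<bar> \<and> \<bar>x - a\<bar> < min (b - a) (a - c)"
    then have "\<bar>x - a\<bar> < b - a" "\<bar>x - a\<bar> < a - c" "x \<noteq> a" by auto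
    then have "c < x" "x < b" "x \<noteq> a" by (auto simp: abs_diff_less_iff')
    then show "\<not> X x" using b(2) c(2) by (cases x a rule: linorder_cases) auto
  qed
qed

section \<open>Uniform finiteness, Baire properties and near-constancy on an interval\<close>

lemma definable_sup:
  assumes "defpred (\<lambda>v. X (v 0))" "X x0" "\<And>x. X x \<Longrightarrow> x \<le> b"
  shows "\<exists>s. (\<forall>x. X x \<longrightarrow> x \<le> s) \<and> (\<forall>z. (\<forall>x. X x \<longrightarrow> x \<le> z) \<longrightarrow> s \<le> z)"
proof -
  have "definable \<M> 1 {x \<in> cart 1. x 0 \<in> Collect X}"
    using defpred_imp_definable[OF assms(1), of 1] by simp
  then obtain s :: "'a extended" where s: "isLub UNIV (Fin ` Collect X) s"
    using DCULOAS unfolding DCULOAS_def definably_complete_def by blast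
  have ub: "Fin x \<le> s" if "X x" for x
    using isLubD2[OF s] that by blast
  have lub: "s \<le> Fin z" if "\<forall>x. X x \<longrightarrow> x \<le> z" for z
    by (rule isLub_le_isUb[OF s]) (use that in \<open>auto intro!: isUbI setleI\<close>)
  obtain s' where s': "s = Fin s'"
    using ub[OF assms(2)] lub[of b] assms(3) by (cases s) auto
  show ?thesis using ub lub unfolding s' by (intro exI[of _ s']) auto
qed

text \<open>Here uniformity in the parameter is essential: one neighbourhood of \<open>a\<close>
  serves all small \<open>r\<close>. A finite union of points and open intervals that contains no
  interval is just its points.\<close>

lemma fibres_uniformly_finite:
  assumes "defpred (\<lambda>v. R (v 0) (v 1))"
  shows "\<exists>r0>0. \<exists>l u. l < a \<and> a < u \<and>
    (\<forall>r. 0 < r \<and> r < r0 \<and> \<not> has_interval (R r) \<longrightarrow> finite {x. l < x \<and> x < u \<and> R r x})"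
proof -
  let ?X = "{w \<in> cart (Suc 1). R (w 0) (w 1)}"
  have def: "definable \<M> (Suc 1) ?X"
    by (rule defpred_imp_definable[OF assms])
  \<comment> \<open>The axiom is used at the limit parameter 0, although only positive parameters
    matter later.\<close>
  define pt :: "'a \<Rightarrow> nat \<Rightarrow> 'a" where "pt r = (\<lambda>i\<in>{..<1}. r)" for r
  have pt: "pt 0 \<in> cart 1" by (simp add: pt_def)
  obtain I B where
    I: "open_interval I" "a \<in> I" and B: "open_box 1 B" "pt 0 \<in> B"
    and fin: "\<And>y. y \<in> B \<Longrightarrow> fin_union_points_intervals ({x. y(1 := x) \<in> ?X} \<inter> I)"
    by (rule uniformly_locally_o_minimalE[OF def pt, of a]) (rule that)
  obtain J where J: "open_interval (J 0)" "B = (\<Pi>\<^sub>E i\<in>{..<1}. J i)"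
    using B by (auto simp: open_box_def)
  have "0 \<in> J 0" using B(2) by (auto simp: J(2) pt_def)
  from open_interval_inner[OF J(1) this] obtain r0 where
    r0: "0 < r0" "\<And>r. 0 < r \<Longrightarrow> r < r0 \<Longrightarrow> r \<in> J 0"
    by (meson less_trans)
  obtain l u where lu: "l < a" "a < u" "\<forall>x. l < x \<and> x < u \<longrightarrow> x \<in> I"
    using open_interval_inner[OF I] by blast
  have "finite {x. l < x \<and> x < u \<and> R r x}" if r: "0 < r" "r < r0" "\<not> has_interval (R r)" for r
  proof -
    have "pt r \<in> B" using r0(2)[OF r(1,2)] by (auto simp: J(2) pt_def)
    moreover have "(pt r)(1 := x) \<in> ?X \<longleftrightarrow> R r x" for x
      by (auto simp: pt_def PiE_def extensional_def)
    ultimately have "fin_union_points_intervals ({x. R r x} \<inter> I)"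
      using fin[of "pt r"] by simp
    then obtain F \<J> where F: "finite F" and \<J>: "\<forall>J\<in>\<J>. open_interval J"
      and eq: "{x. R r x} \<inter> I = F \<union> \<Union>\<J>"
      by (auto simp: fin_union_points_intervals_def)
    have "\<Union>\<J> = {}"
    proof (rule ccontr)
      assume "\<Union>\<J> \<noteq> {}"
      then obtain x J where xJ: "J \<in> \<J>" "x \<in> J" by blast
      with \<J> obtain l u where "l < x" "x < u" "\<forall>y. l < y \<and> y < u \<longrightarrow> y \<in> J"
        using open_interval_inner by blast
      moreover have "J \<subseteq> {x. R r x}" using eq xJ(1) by blast
      ultimately have "has_interval (R r)"
        unfolding has_interval_def by (intro exI[of _ l] exI[of _ u]) auto
      with r(3) show False by blast
    qed
    moreover have "{x. l < x \<and> x < u \<and> R r x} \<subseteq> {x. R r x} \<inter> I" using lu by auto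
    ultimately show ?thesis using F eq by (auto intro: finite_subset)
  qed
  with r0(1) lu show ?thesis by blast
qed

text \<open>
  If no \<open>X r\<close> contained an interval, then every \<open>X r\<close> would
  be finite near some point, uniformly for small \<open>r\<close>. The thresholds \<open>sup {t. X t x}\<close> then
  accumulate at \<open>0\<close>, so by local o-minimality they fill an interval \<open>(0, b)\<close>, although
  only finitely many of them exceed a given \<open>s > 0\<close>.
\<close>

lemma has_interval_Baire_zero:
  assumes def: "defpred (\<lambda>v. X (v 0) (v 1))"
    and mono: "\<And>r s x. 0 < r \<Longrightarrow> r < s \<Longrightarrow> X s x \<Longrightarrow> X r x"
    and int: "has_interval (\<lambda>x. \<exists>r>0. X r x)"
  shows "\<exists>r>0. has_interval (X r)"
proof (rule ccontr)
  assume neg: "\<not> (\<exists>r>0. has_interval (X r))"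
  obtain a b where ab: "a < b" "\<And>x. a < x \<Longrightarrow> x < b \<Longrightarrow> \<exists>r>0. X r x"
    using int by (auto simp: has_interval_def)
  obtain c where c: "a < c" "c < b" using dense[OF ab(1)] by blast
  obtain r0 l0 u0 where r0: "r0 > 0" and lu0: "l0 < c" "c < u0"
    and fin0: "\<And>r. 0 < r \<and> r < r0 \<and> \<not> has_interval (X r) \<Longrightarrow> finite {x. l0 < x \<and> x < u0 \<and> X r x}"
    using fibres_uniformly_finite[OF def, of c] by blast
  define l u where "l = max a l0" and "u = min b u0"
  have lu: "l < u" using c lu0 by (auto simp: l_def u_def)
  have fin: "finite {x. l < x \<and> x < u \<and> X r x}" if "0 < r" "r < r0" for r
    by (rule finite_subset[OF _ fin0[of r]]) (use that neg in \<open>auto simp: l_def u_def\<close>)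
  have ex: "\<exists>r>0. X r x" if "l < x" "x < u" for x
    using ab(2)[of x] that by (auto simp: l_def u_def)
  \<comment> \<open>\<open>s\<close> is the threshold at which some point of \<open>(l, u)\<close>
    leaves the family. Nothing is required at \<open>t = s\<close>, since the supremum may or may
    not be attained.\<close>
  define T where "T s \<longleftrightarrow> 0 < s \<and> (\<exists>x. l < x \<and> x < u \<and>
    (\<forall>t. 0 < t \<and> t < s \<longrightarrow> X t x) \<and> (\<forall>t. s < t \<longrightarrow> \<not> X t x))" for s
  have "defpred (\<lambda>v. T (v 0))"
    unfolding T_def by (intro defpred_intros defpred_bin[OF def])
  from right_o_minimal[OF this, of 0] obtain b' where b': "b' > 0"
    "(\<forall>s. 0 < s \<and> s < b' \<longrightarrow> T s) \<or> (\<forall>s. 0 < s \<and> s < b' \<longrightarrow> \<not> T s)" by blast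
  obtain s0 where s0: "0 < s0" "s0 < min b' r0" using dense[of 0 "min b' r0"] b'(1) r0 by auto
  from b'(2) show False
  proof
    assume "\<forall>s. 0 < s \<and> s < b' \<longrightarrow> T s"
    then have "\<forall>s\<in>{s0<..<b'}. \<exists>x. l < x \<and> x < u \<and> (\<forall>t. 0 < t \<and> t < s \<longrightarrow> X t x) \<and> (\<forall>t. s < t \<longrightarrow> \<not> X t x)"
      using s0(1) less_trans unfolding T_def by fastforce
    then obtain x where x: "\<And>s. s \<in> {s0<..<b'} \<Longrightarrow> l < x s \<and> x s < u \<and>
        (\<forall>t. 0 < t \<and> t < s \<longrightarrow> X t (x s)) \<and> (\<forall>t. s < t \<longrightarrow> \<not> X t (x s))"
      by metis
    \<comment> \<open>A value strictly between two thresholds would be in the family for one of the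
      points and not for the other.\<close>
    have neq: "x s \<noteq> x s'" if ss: "s \<in> {s0<..<b'}" "s' \<in> {s0<..<b'}" "s < s'" for s s'
    proof
      assume eq: "x s = x s'"
      obtain t where t: "s < t" "t < s'" using dense[OF ss(3)] by blast
      have "0 < t" using that(1) s0(1) t(1) by (auto intro: less_trans)
      then show False using x[OF that(1)] x[OF that(2)] t eq by metis
    qed
    then have "inj_on x {s0<..<b'}"
      by (intro linorder_inj_onI) auto
    moreover have "x ` {s0<..<b'} \<subseteq> {x. l < x \<and> x < u \<and> X s0 x}"
      using x s0(1) by auto
    ultimately have "finite {s0<..<b'}"
      using fin[of s0] s0 by (meson finite_imageD finite_subset min_less_iff_conj)
    moreover have "infinite {s0<..<b'}" using s0 by (intro infinite_Ioo) auto
    ultimately show False by blast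
  next
    assume noT: "\<forall>s. 0 < s \<and> s < b' \<longrightarrow> \<not> T s"
    \<comment> \<open>A point outside \<open>X s0\<close> has its threshold in
      \<open>(0, s0]\<close>, which lies below \<open>b'\<close> and is excluded by
      \<open>noT\<close>.\<close>
    have "X s0 x" if x: "l < x" "x < u" for x
    proof (rule ccontr)
      assume nX: "\<not> X s0 x"
      have le: "t \<le> s0" if "0 < t \<and> X t x" for t
        using that nX mono[OF s0(1), of t x] by (meson not_le)
      obtain t0 where t0: "0 < t0 \<and> X t0 x" using ex[OF x] by blast
      have "defpred (\<lambda>v. 0 < v 0 \<and> X (v 0) x)"
        by (intro defpred_intros defpred_bin[OF def])
      from definable_sup[OF this t0, OF le] obtain s where
        s: "\<And>t. 0 < t \<and> X t x \<Longrightarrow> t \<le> s" "\<And>z. (\<forall>t. 0 < t \<and> X t x \<longrightarrow> t \<le> z) \<Longrightarrow> s \<le> z"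
        by blast
      have "0 < s" using s(1)[OF t0] t0 by auto
      moreover have "s < b'" using s(2)[of s0] le s0 by auto
      moreover have "X t x" if t: "0 < t \<and> t < s" for t
      proof -
        obtain t' where "0 < t' \<and> X t' x" "t < t'"
          using s(2)[of t] t by (meson not_le)
        then show ?thesis using mono[of t t' x] t by auto
      qed
      moreover have "\<not> X t x" if "s < t" for t
        using s(1)[of t] that \<open>0 < s\<close> by (meson less_trans not_le)
      ultimately have "T s" unfolding T_def using x by blast
      with noT \<open>0 < s\<close> \<open>s < b'\<close> show False by blast
    qed
    then have "has_interval (X s0)" using lu unfolding has_interval_def by blast
    with neg s0(1) show False by blast
  qed
qed

text \<open>
  Otherwise every \<open>X r\<close> is discrete, so a neighbourhood of each point \<open>x\<close> consists of points
  that enter the family strictly later than \<open>x\<close>. On an interval where the radius of this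
  neighbourhood is bounded below, two close points would each enter later than the other.
\<close>

lemma has_interval_Baire_infinity:
  assumes def: "defpred (\<lambda>v. X (v 0) (v 1))"
    and mono: "\<And>r s x. r < s \<Longrightarrow> X r x \<Longrightarrow> X s x"
    and int: "has_interval (\<lambda>x. \<exists>r. X r x)"
  shows "\<exists>r. has_interval (X r)"
proof (rule ccontr)
  assume neg: "\<not> (\<exists>r. has_interval (X r))"
  \<comment> \<open>Quantifying \<open>r\<close> away leaves the radius \<open>k\<close> as the only
    parameter, so the Baire property at 0 applies to \<open>Y\<close>.\<close>
  define Y where "Y k x \<longleftrightarrow> (\<exists>r. X r x \<and> (\<forall>y. 0 < \<bar>y - x\<bar> \<and> \<bar>y - x\<bar> < k \<longrightarrow> \<not> X r y))" for k x
  have "\<exists>k>0. Y k x" if ex: "\<exists>r. X r x" for x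
  proof -
    obtain r where r: "X r x" using ex by blast
    have "defpred (\<lambda>v. X r (v 0))" by (intro defpred_intros defpred_bin[OF def])
    from punctured_nbhd_avoids[OF this, of x] neg r show ?thesis
      unfolding Y_def by blast
  qed
  then have "has_interval (\<lambda>x. \<exists>k>0. Y k x)"
    by (rule has_interval_mono[OF int])
  moreover have "defpred (\<lambda>v. Y (v 0) (v 1))"
    unfolding Y_def by (intro defpred_intros defpred_bin[OF def])
  moreover have "Y k x" if "0 < k" "k < k'" "Y k' x" for k k' x
    using that(3) order_less_trans[OF _ that(2)] unfolding Y_def by blast
  ultimately have "\<exists>k>0. has_interval (Y k)"
    by (intro has_interval_Baire_zero)
  then obtain k a b where k: "k > 0" and ab: "a < b" "\<And>x. a < x \<Longrightarrow> x < b \<Longrightarrow> Y k x"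
    unfolding has_interval_def by blast
  obtain x where x: "a < x" "x < b" using dense[OF ab(1)] by blast
  obtain y where y: "x < y" "y < min b (x + k)" using dense[of x "min b (x + k)"] x k by auto
  have "\<bar>y - x\<bar> < k" "\<bar>x - y\<bar> < k" "0 < \<bar>y - x\<bar>" "0 < \<bar>x - y\<bar>"
    using y k by (auto simp: abs_diff_less_iff' abs_minus_commute less_diff_eq diff_less_eq
        add.commute intro: less_trans)
  moreover obtain r where r: "X r x" "\<forall>y. 0 < \<bar>y - x\<bar> \<and> \<bar>y - x\<bar> < k \<longrightarrow> \<not> X r y"
    using ab(2)[OF x] unfolding Y_def by blast
  moreover obtain s where s: "X s y" "\<forall>x. 0 < \<bar>x - y\<bar> \<and> \<bar>x - y\<bar> < k \<longrightarrow> \<not> X s x"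
    using ab(2)[of y] x y unfolding Y_def by (auto intro: less_trans)
  ultimately have "\<not> X r y" "\<not> X s x" by blast+
  with r(1) s(1) mono show False by (metis linorder_cases)
qed

text \<open>\<open>S\<close> is a multivalued function. The constant \<open>c\<close> is the limit
  inferior, from the right at an inner point, of its infimum over bounded values. The dichotomy of
  germs turns "values near \<open>c\<close> arbitrarily close to the point" into "values near
  \<open>c\<close> at all close points".\<close>

lemma has_interval_near:
  assumes def: "defpred (\<lambda>v. S (v 0) (v 1))"
    and int: "has_interval (\<lambda>x. \<exists>y. S x y)" and \<epsilon>: "0 < \<epsilon>"
  shows "\<exists>c. has_interval (\<lambda>x. \<exists>y. \<bar>y - c\<bar> \<le> \<epsilon> \<and> S x y)"
proof -
  \<comment> \<open>Bounding the values on a subinterval makes the supremum taken below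
    finite.\<close>
  have "\<exists>r. has_interval (\<lambda>x. \<exists>y. \<bar>y\<bar> \<le> r \<and> S x y)"
  proof (rule has_interval_Baire_infinity)
    show "defpred (\<lambda>v. \<exists>y. \<bar>y\<bar> \<le> v 0 \<and> S (v 1) y)"
      by (intro defpred_intros defpred_bin[OF def])
    show "has_interval (\<lambda>x. \<exists>r y. \<bar>y\<bar> \<le> r \<and> S x y)"
      by (rule has_interval_mono[OF int]) auto
  qed (meson less_imp_le order_trans)
  then obtain r a b where ab: "a < b" "\<And>x. a < x \<Longrightarrow> x < b \<Longrightarrow> \<exists>y. \<bar>y\<bar> \<le> r \<and> S x y"
    unfolding has_interval_def by blast
  obtain p where p: "a < p" "p < b" using dense[OF ab(1)] by blast
  define A where "A c x \<longleftrightarrow> (\<exists>y. \<bar>y\<bar> \<le> r \<and> y \<le> c \<and> S x y)" for c x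
  have A: "defpred (\<lambda>v. A (v 0) (v 1))"
    unfolding A_def by (intro defpred_intros defpred_bin[OF def])
  \<comment> \<open>\<open>c\<close> lies strictly below, or at most at, the limit inferior:
    eventually no bounded value is at most \<open>c\<close>.\<close>
  define L where "L c \<longleftrightarrow> (\<exists>q>p. \<forall>x. p < x \<and> x < q \<longrightarrow> \<not> A c x)" for c
  have "defpred (\<lambda>v. L (v 0))"
    unfolding L_def by (intro defpred_intros defpred_bin[OF A])
  moreover have "L (- r - \<epsilon>)"
    unfolding L_def A_def
  proof (intro exI[of _ b] conjI allI impI notI)
    fix x assume "\<exists>y. \<bar>y\<bar> \<le> r \<and> y \<le> - r - \<epsilon> \<and> S x y"
    then obtain y where y: "\<bar>y\<bar> \<le> r" "y \<le> - r - \<epsilon>" by blast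
    then have "- r \<le> y" by (auto simp: abs_le_iff_ab_group minus_le_iff)
    from this y(2) have "- r \<le> - r - \<epsilon>" by (rule order_trans)
    with \<epsilon> show False by simp
  qed (use p in auto)
  moreover have "c \<le> r" if "L c" for c
  proof (rule ccontr)
    assume "\<not> c \<le> r"
    obtain q where q: "q > p" "\<And>x. p < x \<Longrightarrow> x < q \<Longrightarrow> \<not> A c x" using \<open>L c\<close> unfolding L_def by blast
    obtain x where x: "p < x" "x < min b q" using dense[of p "min b q"] p q by auto
    with q(2) have "\<not> A c x" by auto
    moreover obtain y where "\<bar>y\<bar> \<le> r" "S x y" using ab(2)[of x] x p by (auto intro: less_trans)
    moreover from this have "y \<le> c" using \<open>\<not> c \<le> r\<close> by (auto simp: abs_le_iff_ab_group)
    ultimately show False unfolding A_def by blast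
  qed
  ultimately obtain s where s: "\<And>c. L c \<Longrightarrow> c \<le> s" "\<And>z. (\<forall>c. L c \<longrightarrow> c \<le> z) \<Longrightarrow> s \<le> z"
    using definable_sup[of L] by metis
  \<comment> \<open>Failure of \<open>L\<close> only yields values at most
    \<open>s + \<epsilon>\<close> at points arbitrarily close to \<open>p\<close>; the right germ
    being full or empty yields them throughout an interval.\<close>
  have "\<not> L (s + \<epsilon>)" using s(1)[of "s + \<epsilon>"] \<epsilon> by auto
  moreover have "defpred (\<lambda>v. A (s + \<epsilon>) (v 0))"
    by (intro defpred_intros defpred_bin[OF A])
  ultimately obtain q where q: "q > p" "\<And>x. p < x \<Longrightarrow> x < q \<Longrightarrow> A (s + \<epsilon>) x"
    using right_o_minimal[of "A (s + \<epsilon>)" p] unfolding L_def by blast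
  have "\<not> (\<forall>c. L c \<longrightarrow> c \<le> s - \<epsilon>)"
  proof
    assume "\<forall>c. L c \<longrightarrow> c \<le> s - \<epsilon>"
    then have "s \<le> s - \<epsilon>" by (rule s(2))
    with \<epsilon> show False by simp
  qed
  then obtain c where c: "L c" "s - \<epsilon> < c" unfolding not_all not_imp not_le by blast
  then obtain q' where q': "q' > p" "\<And>x. p < x \<Longrightarrow> x < q' \<Longrightarrow> \<not> A c x" unfolding L_def by blast
  have "\<exists>y. \<bar>y - s\<bar> \<le> \<epsilon> \<and> S x y" if x: "p < x" "x < min q q'" for x
  proof -
    obtain y where y: "\<bar>y\<bar> \<le> r" "y \<le> s + \<epsilon>" "S x y"
      using q(2)[of x] x unfolding A_def by auto
    then have "\<not> y \<le> c" using q'(2)[of x] x unfolding A_def by auto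
    with c(2) have "s - \<epsilon> \<le> y" by auto
    with y show ?thesis by (auto simp: abs_diff_le_iff')
  qed
  moreover have "p < min q q'" using q q' by simp
  ultimately show ?thesis unfolding has_interval_def by blast
qed

end

section \<open>Boxes\<close>

lemma has_box_0: "has_box 0 X \<longleftrightarrow> X (\<lambda>_. undefined)"
  by (simp add: has_box_def)

lemma fun_upd_in_cart_Suc: "w \<in> cart n \<Longrightarrow> w(n := x) \<in> cart (Suc n)"
  by (auto simp: PiE_def extensional_def)

lemma cart_upd_undefined: "w \<in> cart n \<Longrightarrow> w(n := undefined) = w"
  by (auto simp: PiE_def extensional_def)

lemma cart_restrict: "w \<in> cart n \<Longrightarrow> restrict w {..<n} = w"
  by (rule PiE_restrict)

lemma has_boxE:
  assumes "has_box n X"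
  obtains l u where "\<And>i. i < n \<Longrightarrow> l i < u i"
    "\<And>w. w \<in> cart n \<Longrightarrow> \<forall>i<n. l i < w i \<and> w i < u i \<Longrightarrow> X w"
proof -
  from assms[unfolded has_box_def] obtain l u where
    lu: "\<forall>i<n. l i < u i" "\<forall>w\<in>cart n. (\<forall>i<n. l i < w i \<and> w i < u i) \<longrightarrow> X w"
    by (elim exE conjE)
  show thesis
  proof (rule that)
    show "l i < u i" if "i < n" for i using lu(1) that by simp
    show "X w" if "w \<in> cart n" "\<forall>i<n. l i < w i \<and> w i < u i" for w
      using lu(2)[rule_format, OF that(1)] that(2) by simp
  qed
qed

lemma has_box_fibres:
  assumes "has_box (Suc n) X"
  shows "has_box n (\<lambda>w. has_interval (\<lambda>x. X (w(n := x))))"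
proof -
  obtain l u where lu: "\<And>i. i < Suc n \<Longrightarrow> l i < u i"
    "\<And>w. w \<in> cart (Suc n) \<Longrightarrow> \<forall>i<Suc n. l i < w i \<and> w i < u i \<Longrightarrow> X w"
    by (rule has_boxE[OF assms]) (rule that)
  show ?thesis
    unfolding has_box_def has_interval_def
  proof (intro exI conjI ballI impI allI)
    show "l i < u i" if "i < n" for i using lu(1) that by simp
    show "l n < u n" using lu(1) by simp
    show "X (w(n := x))" if "w \<in> cart n" "\<forall>i<n. l i < w i \<and> w i < u i" "l n < x \<and> x < u n" for w x
      by (rule lu(2)[OF fun_upd_in_cart_Suc]) (use that in \<open>auto simp: less_Suc_eq\<close>)
  qed
qed

lemma has_box_SucI:
  assumes "a < b" and "has_box n (\<lambda>w. \<forall>x. a < x \<and> x < b \<longrightarrow> X (w(n := x)))"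
  shows "has_box (Suc n) X"
proof -
  obtain l u where lu: "\<And>i. i < n \<Longrightarrow> l i < u i"
    "\<And>w. w \<in> cart n \<Longrightarrow> \<forall>i<n. l i < w i \<and> w i < u i \<Longrightarrow>
      \<forall>x. a < x \<and> x < b \<longrightarrow> X (w(n := x))"
    by (rule has_boxE[OF assms(2)]) (rule that)
  show ?thesis
    unfolding has_box_def
  proof (intro exI conjI ballI impI allI)
    show "(l(n := a)) i < (u(n := b)) i" if "i < Suc n" for i
      using lu(1) assms(1) that by auto
    fix w assume w: "w \<in> cart (Suc n)" "\<forall>i<Suc n. (l(n := a)) i < w i \<and> w i < (u(n := b)) i"
    have "w(n := undefined) \<in> cart n" using w(1) by (auto simp: PiE_def extensional_def)
    moreover have "\<forall>i<n. l i < (w(n := undefined)) i \<and> (w(n := undefined)) i < u i"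
      using w(2) by (metis fun_upd_other less_SucI less_not_refl)
    moreover have "a < w n \<and> w n < b" using w(2) by auto
    ultimately have "X ((w(n := undefined))(n := w n))" by (rule lu(2)[THEN spec, THEN mp])
    then show "X w" by simp
  qed
qed

context dculoas
begin

text \<open>
  In both statements the coordinate \<open>n\<close> of the argument of the predicate is the family
  parameter, respectively the value.
\<close>

definition box_Baire :: "nat \<Rightarrow> bool" where
  "box_Baire n \<longleftrightarrow> (\<forall>X. defpred X \<longrightarrow>
    (\<forall>w\<in>cart n. \<forall>r s. 0 < r \<and> r < s \<and> X (w(n := s)) \<longrightarrow> X (w(n := r))) \<longrightarrow>
    has_box n (\<lambda>w. \<exists>r>0. X (w(n := r))) \<longrightarrow> (\<exists>r>0. has_box n (\<lambda>w. X (w(n := r)))))"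

definition box_near :: "nat \<Rightarrow> bool" where
  "box_near n \<longleftrightarrow> (\<forall>S \<epsilon>. defpred S \<longrightarrow> 0 < \<epsilon> \<longrightarrow> has_box n (\<lambda>w. \<exists>y. S (w(n := y))) \<longrightarrow>
    (\<exists>c. has_box n (\<lambda>w. \<exists>y. \<bar>y - c\<bar> \<le> \<epsilon> \<and> S (w(n := y)))))"

lemma box_BaireD:
  assumes "box_Baire n" "defpred X"
    and "\<And>w r s. w \<in> cart n \<Longrightarrow> 0 < r \<Longrightarrow> r < s \<Longrightarrow> X (w(n := s)) \<Longrightarrow> X (w(n := r))"
    and "has_box n (\<lambda>w. \<exists>r>0. X (w(n := r)))"
  shows "\<exists>r>0. has_box n (\<lambda>w. X (w(n := r)))"
  by (rule assms(1)[unfolded box_Baire_def, rule_format, OF assms(2) _ assms(4)])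
    (elim conjE, rule assms(3))

lemma box_nearD:
  assumes "box_near n" "defpred S" "0 < \<epsilon>" "has_box n (\<lambda>w. \<exists>y. S (w(n := y)))"
  shows "\<exists>c. has_box n (\<lambda>w. \<exists>y. \<bar>y - c\<bar> \<le> \<epsilon> \<and> S (w(n := y)))"
  by (rule assms(1)[unfolded box_near_def, rule_format, OF assms(2-4)])

text \<open>The Kuratowski-Ulam step. The Baire property gives the fibre intervals a common radius,
  near-constancy gives them nearly equal centres; then they share an interval.\<close>

lemma has_box_Suc_if_Baire_near:
  assumes "box_Baire n" "box_near n" and X: "defpred X"
    and "has_box n (\<lambda>w. has_interval (\<lambda>x. X (w(n := x))))"
  shows "has_box (Suc n) X"
proof -
  \<comment> \<open>Coordinate \<open>n\<close> carries the radius here and the centre in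
    \<open>?S\<close> below; inside \<open>X\<close> it is overwritten by \<open>x\<close>.\<close>
  let ?Y = "\<lambda>v. \<exists>c. \<forall>x. \<bar>x - c\<bar> < v n \<longrightarrow> X (v(n := x))"
  have "defpred ?Y"
    by (intro defpred_intros defpred_subst[OF X])
  moreover have "has_box n (\<lambda>w. \<exists>h>0. ?Y (w(n := h)))"
    using assms(4) by (rule has_box_mono) (auto elim!: has_intervalE)
  moreover have "?Y (w(n := r))" if "r < s" "?Y (w(n := s))" for w r s
    using that(2) order_less_trans[OF _ that(1)] by auto
  ultimately obtain h where h: "h > 0" "has_box n (\<lambda>w. ?Y (w(n := h)))"
    using box_BaireD[OF assms(1), of ?Y] by blast
  let ?S = "\<lambda>v. \<forall>x. \<bar>x - v n\<bar> < h \<longrightarrow> X (v(n := x))"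
  obtain \<epsilon> where \<epsilon>: "0 < \<epsilon>" "\<epsilon> < h" using dense[OF h(1)] by blast
  have "defpred ?S"
    by (intro defpred_intros defpred_subst[OF X])
  moreover have "has_box n (\<lambda>w. \<exists>y. ?S (w(n := y)))" using h(2) by simp
  ultimately obtain c where "has_box n (\<lambda>w. \<exists>y. \<bar>y - c\<bar> \<le> \<epsilon> \<and> ?S (w(n := y)))"
    using box_nearD[OF assms(2), of ?S \<epsilon>] \<epsilon>(1) by blast
  then have "has_box n (\<lambda>w. \<forall>x. c - (h - \<epsilon>) < x \<and> x < c + (h - \<epsilon>) \<longrightarrow> X (w(n := x)))"
  proof (rule has_box_mono, intro allI impI)
    fix w :: "nat \<Rightarrow> 'a" and x
    assume "\<exists>y. \<bar>y - c\<bar> \<le> \<epsilon> \<and> ?S (w(n := y))" and "c - (h - \<epsilon>) < x \<and> x < c + (h - \<epsilon>)"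
    then obtain y where y: "\<bar>c - y\<bar> \<le> \<epsilon>" "?S (w(n := y))" and x: "\<bar>x - c\<bar> < h - \<epsilon>"
      unfolding abs_diff_less_iff'[of x c] abs_minus_commute[of c] by blast
    have "\<bar>x - y\<bar> \<le> \<bar>x - c\<bar> + \<bar>c - y\<bar>" by (rule abs_diff_triangle)
    also have "\<dots> < (h - \<epsilon>) + \<epsilon>" using x y(1) by (rule add_less_le_mono)
    finally show "X (w(n := x))" using y(2) by simp
  qed
  moreover have "c - (h - \<epsilon>) < c" "c < c + (h - \<epsilon>)" using \<epsilon>(2) by auto
  then have "c - (h - \<epsilon>) < c + (h - \<epsilon>)" by (rule less_trans)
  ultimately show ?thesis by (intro has_box_SucI)
qed

text \<open>The two properties must be proved together: both in dimension \<open>n\<close> are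
  needed for Kuratowski-Ulam in dimension \<open>Suc n\<close>. This reduces each claim to intervals
  in the fibres, where the one-variable result applies, and the induction hypothesis makes its
  outcome uniform over the base.\<close>

lemma box_Baire_near: "box_Baire n \<and> box_near n"
proof (induction n)
  case 0
  \<comment> \<open>Over a single point the value itself is the constant.\<close>
  have "box_near 0"
    unfolding box_near_def has_box_0
    by (metis abs_zero cancel_comm_monoid_add_class.diff_cancel less_imp_le)
  then show ?case by (auto simp: box_Baire_def has_box_0)
next
  case (Suc n)
  have "box_Baire (Suc n)"
    unfolding box_Baire_def
  proof (intro allI impI)
    fix X :: "(nat \<Rightarrow> 'a) \<Rightarrow> bool"
    assume X: "defpred X"
      and mono: "\<forall>w\<in>cart (Suc n). \<forall>r s. 0 < r \<and> r < s \<and> X (w(Suc n := s)) \<longrightarrow> X (w(Suc n := r))"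
      and box: "has_box (Suc n) (\<lambda>w. \<exists>r>0. X (w(Suc n := r)))"
    \<comment> \<open>The family parameter sits at \<open>n\<close> for the induction hypothesis and
      is copied to \<open>Suc n\<close> before \<open>x\<close> takes its place.\<close>
    let ?Y = "\<lambda>v. has_interval (\<lambda>x. X (v(n := x, Suc n := v n)))"
    have mono': "X (w(n := x, Suc n := r))"
      if "w \<in> cart n" "0 < r" "r < s" "X (w(n := x, Suc n := s))" for w r s x
      using mono fun_upd_in_cart_Suc[OF that(1)] that(2-) by blast
    have "defpred ?Y"
      by (intro defpred_intros defpred_has_interval defpred_subst[OF X])
    moreover have "has_box n (\<lambda>w. \<exists>r>0. ?Y (w(n := r)))"
      using has_box_fibres[OF box]
    proof (rule has_box_mono)
      fix w :: "nat \<Rightarrow> 'a"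
      assume w: "w \<in> cart n" and int: "has_interval (\<lambda>x. \<exists>r>0. X (w(n := x, Suc n := r)))"
      have "\<exists>r>0. has_interval (\<lambda>x. X (w(n := x, Suc n := r)))"
        by (rule has_interval_Baire_zero[OF _ _ int])
          (intro defpred_intros defpred_subst[OF X], rule mono'[OF w])
      then show "\<exists>r>0. ?Y (w(n := r))" by simp
    qed
    moreover have "?Y (w(n := r))" if "w \<in> cart n" "0 < r" "r < s" "?Y (w(n := s))" for w r s
      using has_interval_mono[OF that(4), of "\<lambda>x. X (w(n := x, Suc n := r))"] mono'[OF that(1-3)]
      by simp
    ultimately obtain r where r: "r > 0" "has_box n (\<lambda>w. ?Y (w(n := r)))"
      using box_BaireD[of n ?Y] Suc.IH by blast
    have "has_box (Suc n) (\<lambda>w. X (w(Suc n := r)))"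
      using Suc.IH
    proof (elim conjE, intro has_box_Suc_if_Baire_near)
      show "defpred (\<lambda>w. X (w(Suc n := r)))"
        by (intro defpred_intros defpred_subst[OF X])
    qed (use r(2) in simp_all)
    with r(1) show "\<exists>r>0. has_box (Suc n) (\<lambda>w. X (w(Suc n := r)))" by blast
  qed
  moreover have "box_near (Suc n)"
    unfolding box_near_def
  proof (intro allI impI)
    fix S :: "(nat \<Rightarrow> 'a) \<Rightarrow> bool" and \<epsilon> :: 'a
    assume S: "defpred S" and \<epsilon>: "0 < \<epsilon>" and box: "has_box (Suc n) (\<lambda>w. \<exists>y. S (w(Suc n := y)))"
    \<comment> \<open>One error arises in the fibre, another in moving the fibre constants to a
      common one.\<close>
    obtain \<eta> where \<eta>: "0 < \<eta>" "\<eta> + \<eta> < \<epsilon>" using ex_add_self_less[OF \<epsilon>] by blast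
    let ?T = "\<lambda>v. has_interval (\<lambda>x. \<exists>y. \<bar>y - v n\<bar> \<le> \<eta> \<and> S (v(n := x, Suc n := y)))"
    have "defpred ?T"
      by (intro defpred_intros defpred_has_interval defpred_subst[OF S])
    moreover have "has_box n (\<lambda>w. \<exists>c. ?T (w(n := c)))"
      using has_box_fibres[OF box]
    proof (rule has_box_mono)
      fix w :: "nat \<Rightarrow> 'a"
      assume int: "has_interval (\<lambda>x. \<exists>y. S (w(n := x, Suc n := y)))"
      have "\<exists>c. has_interval (\<lambda>x. \<exists>y. \<bar>y - c\<bar> \<le> \<eta> \<and> S (w(n := x, Suc n := y)))"
        by (rule has_interval_near[OF _ int \<eta>(1)]) (intro defpred_intros defpred_subst[OF S])
      then show "\<exists>c. ?T (w(n := c))" by simp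
    qed
    ultimately obtain c where c: "has_box n (\<lambda>w. \<exists>c'. \<bar>c' - c\<bar> \<le> \<eta> \<and> ?T (w(n := c')))"
      using box_nearD[of n ?T \<eta>] Suc.IH \<eta>(1) by blast
    have "has_box (Suc n) (\<lambda>w. \<exists>y. \<bar>y - c\<bar> \<le> \<epsilon> \<and> S (w(Suc n := y)))"
      using Suc.IH
    proof (elim conjE, intro has_box_Suc_if_Baire_near)
      show "defpred (\<lambda>w. \<exists>y. \<bar>y - c\<bar> \<le> \<epsilon> \<and> S (w(Suc n := y)))"
        by (intro defpred_intros defpred_subst[OF S])
      show "has_box n (\<lambda>w. has_interval (\<lambda>x. \<exists>y. \<bar>y - c\<bar> \<le> \<epsilon> \<and> S (w(n := x, Suc n := y))))"
        using c
      proof (rule has_box_mono)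
        fix w :: "nat \<Rightarrow> 'a"
        assume "\<exists>c'. \<bar>c' - c\<bar> \<le> \<eta> \<and> ?T (w(n := c'))"
        then obtain c' where c': "\<bar>c' - c\<bar> \<le> \<eta>"
          "has_interval (\<lambda>x. \<exists>y. \<bar>y - c'\<bar> \<le> \<eta> \<and> S (w(n := x, Suc n := y)))"
          by auto
        have "\<bar>y - c\<bar> \<le> \<epsilon>" if "\<bar>y - c'\<bar> \<le> \<eta>" for y
        proof -
          have "\<bar>y - c\<bar> \<le> \<bar>y - c'\<bar> + \<bar>c' - c\<bar>" by (rule abs_diff_triangle)
          also have "\<dots> \<le> \<eta> + \<eta>" using that c'(1) by (rule add_mono)
          finally show ?thesis using \<eta>(2) by simp
        qed
        then show "has_interval (\<lambda>x. \<exists>y. \<bar>y - c\<bar> \<le> \<epsilon> \<and> S (w(n := x, Suc n := y)))"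
          by (intro has_interval_mono[OF c'(2)]) blast
      qed
    qed
    then show "\<exists>c. has_box (Suc n) (\<lambda>w. \<exists>y. \<bar>y - c\<bar> \<le> \<epsilon> \<and> S (w(Suc n := y)))" by blast
  qed
  ultimately show ?case by blast
qed

section \<open>Consequences in every dimension: ideals of small sets and localisation\<close>

lemma has_box_Baire:
  assumes "defpred X"
    and "\<And>w r s. w \<in> cart n \<Longrightarrow> 0 < r \<Longrightarrow> r < s \<Longrightarrow> X (w(n := s)) \<Longrightarrow> X (w(n := r))"
    and "has_box n (\<lambda>w. \<exists>r>0. X (w(n := r)))"
  shows "\<exists>r>0. has_box n (\<lambda>w. X (w(n := r)))"
  by (rule box_BaireD[OF conjunct1[OF box_Baire_near] assms])

lemma has_box_near:
  assumes "defpred S" and "0 < \<epsilon>" and "has_box n (\<lambda>w. \<exists>y. S (w(n := y)))"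
  shows "\<exists>c. has_box n (\<lambda>w. \<exists>y. \<bar>y - c\<bar> \<le> \<epsilon> \<and> S (w(n := y)))"
  by (rule box_nearD[OF conjunct2[OF box_Baire_near] assms])

lemma has_box_Suc:
  assumes "defpred X" and "has_box n (\<lambda>w. has_interval (\<lambda>x. X (w(n := x))))"
  shows "has_box (Suc n) X"
  using box_Baire_near[of n] assms by (intro has_box_Suc_if_Baire_near) auto

text \<open>Apply \<open>has_box_near\<close> to a function that is \<open>0\<close> on \<open>X\<close> and a positive constant on \<open>Y\<close>.\<close>

lemma has_box_disj:
  assumes "defpred X" "defpred Y" "has_box n (\<lambda>w. X w \<or> Y w)"
  shows "has_box n X \<or> has_box n Y"
proof -
  obtain k :: 'a where k: "0 < k" using nontrivial by blast
  obtain \<epsilon> where \<epsilon>: "0 < \<epsilon>" "\<epsilon> + \<epsilon> < k" using ex_add_self_less[OF k] by blast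
  \<comment> \<open>Resetting coordinate \<open>n\<close> to \<open>undefined\<close> recovers the
    point of \<open>cart n\<close> that carries the value.\<close>
  let ?S = "\<lambda>v. (v n = 0 \<and> X (v(n := undefined))) \<or> (v n = k \<and> Y (v(n := undefined)))"
  have "defpred ?S"
    by (intro defpred_intros assms(1,2)[THEN defpred_subst])
  moreover have "has_box n (\<lambda>w. \<exists>y. ?S (w(n := y)))"
    using assms(3) by (rule has_box_mono) (auto simp: cart_upd_undefined)
  ultimately obtain c where c: "has_box n (\<lambda>w. \<exists>y. \<bar>y - c\<bar> \<le> \<epsilon> \<and> ?S (w(n := y)))"
    using has_box_near[of ?S \<epsilon> n] \<epsilon>(1) by blast
  have c': "has_box n (\<lambda>w. (\<bar>0 - c\<bar> \<le> \<epsilon> \<and> X w) \<or> (\<bar>k - c\<bar> \<le> \<epsilon> \<and> Y w))"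
    using c
  proof (rule has_box_mono)
    fix w assume w: "w \<in> cart n" and "\<exists>y. \<bar>y - c\<bar> \<le> \<epsilon> \<and> ?S (w(n := y))"
    then obtain y where "\<bar>y - c\<bar> \<le> \<epsilon>" "?S (w(n := y))" by blast
    then show "(\<bar>0 - c\<bar> \<le> \<epsilon> \<and> X w) \<or> (\<bar>k - c\<bar> \<le> \<epsilon> \<and> Y w)"
      by (auto simp: cart_upd_undefined[OF w])
  qed
  show ?thesis
  proof (cases "\<bar>0 - c\<bar> \<le> \<epsilon>")
    case True
    have "\<not> \<bar>k - c\<bar> \<le> \<epsilon>"
    proof
      assume "\<bar>k - c\<bar> \<le> \<epsilon>"
      then have "\<bar>k - c\<bar> + \<bar>c - 0\<bar> \<le> \<epsilon> + \<epsilon>"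
        using True by (intro add_mono) auto
      then have "\<bar>k - 0\<bar> \<le> \<epsilon> + \<epsilon>"
        by (rule order_trans[OF abs_diff_triangle])
      with \<epsilon> k show False by auto
    qed
    then have "has_box n X"
      by (intro has_box_mono[OF c']) blast
    then show ?thesis ..
  next
    case False
    then have "has_box n Y"
      by (intro has_box_mono[OF c']) blast
    then show ?thesis ..
  qed
qed

text \<open>Definable sets without a box form an ideal by \<open>has_box_disj\<close>; the
  \<open>B i\<close> are removed one at a time.\<close>

lemma has_box_avoid:
  fixes N :: nat
  assumes X: "defpred X" "has_box n X"
    and B: "\<And>i. i < N \<Longrightarrow> defpred (B i)" "\<And>i. i < N \<Longrightarrow> \<not> has_box n (B i)"
  shows "has_box n (\<lambda>w. X w \<and> (\<forall>i<N. \<not> B i w))"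
  using B
proof (induction N)
  case 0
  with X show ?case by simp
next
  case (Suc N)
  let ?Y = "\<lambda>w. X w \<and> (\<forall>i<N. \<not> B i w)"
  have "has_box n (\<lambda>w. ?Y w \<and> \<not> B N w) \<or> has_box n (B N)"
  proof (rule has_box_disj)
    show "defpred (\<lambda>w. ?Y w \<and> \<not> B N w)"
      using Suc.prems(1) by (intro defpred_intros X(1)) auto
    show "defpred (B N)" using Suc.prems(1) by simp
    have "has_box n ?Y" using Suc by auto
    then show "has_box n (\<lambda>w. (?Y w \<and> \<not> B N w) \<or> B N w)"
      by (rule has_box_mono) blast
  qed
  moreover have "\<not> has_box n (B N)" using Suc.prems(2) by simp
  ultimately have "has_box n (\<lambda>w. ?Y w \<and> \<not> B N w)" by blast
  then show ?case by (rule has_box_mono) (auto simp: less_Suc_eq)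
qed

text \<open>Near-constancy is applied to one coordinate of the witness after the other. Earlier
  constraints stay inside the relation, so a single witness satisfies all of them at the
  end.\<close>

lemma has_box_localize:
  fixes Z :: "(nat \<Rightarrow> 'a) \<Rightarrow> (nat \<Rightarrow> 'a) \<Rightarrow> bool"
  assumes Z: "defpred (\<lambda>v. Z (\<lambda>i\<in>{..<d}. v (N + i)) (\<lambda>i\<in>{..<N}. v i))"
    and box: "has_box d (\<lambda>w. \<exists>q\<in>cart N. Z w q)" and \<eta>: "0 < \<eta>"
  shows "\<exists>a. has_box d (\<lambda>w. \<exists>q\<in>cart N. Z w q \<and> (\<forall>i<N. \<bar>q i - a i\<bar> \<le> \<eta>))"
proof -
  have "\<exists>a. has_box d (\<lambda>w. \<exists>q\<in>cart N. Z w q \<and> (\<forall>i<K. \<bar>q i - a i\<bar> \<le> \<eta>))" if "K \<le> N" for K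
    using that
  proof (induction K)
    case 0
    then show ?case using box by simp
  next
    case (Suc K)
    then obtain a where a: "has_box d (\<lambda>w. \<exists>q\<in>cart N. Z w q \<and> (\<forall>i<K. \<bar>q i - a i\<bar> \<le> \<eta>))"
      by auto
    \<comment> \<open>Coordinate \<open>d\<close> holds the value of \<open>q K\<close>; the
      restriction hides it from \<open>Z\<close>.\<close>
    let ?S = "\<lambda>v. \<exists>q\<in>cart N. (Z (restrict v {..<d}) q \<and> (\<forall>i<K. \<bar>q i - a i\<bar> \<le> \<eta>)) \<and> q K = v d"
    have eq: "restrict (w(d := y)) {..<d} = w" if "w \<in> cart d" for w and y :: 'a
      using cart_restrict[OF that] by (auto simp: fun_eq_iff restrict_def split: if_splits)
    have "defpred ?S"
      by (intro defpred_intros Z)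
    moreover have "has_box d (\<lambda>w. \<exists>y. ?S (w(d := y)))"
      using a by (rule has_box_mono) (auto simp: eq)
    ultimately obtain c where c: "has_box d (\<lambda>w. \<exists>y. \<bar>y - c\<bar> \<le> \<eta> \<and> ?S (w(d := y)))"
      using has_box_near[of ?S \<eta> d] \<eta> by blast
    have "has_box d (\<lambda>w. \<exists>q\<in>cart N. Z w q \<and> (\<forall>i<Suc K. \<bar>q i - (a(K := c)) i\<bar> \<le> \<eta>))"
      using c
    proof (rule has_box_mono)
      fix w assume w: "w \<in> cart d" and "\<exists>y. \<bar>y - c\<bar> \<le> \<eta> \<and> ?S (w(d := y))"
      then obtain q where q: "q \<in> cart N" "Z w q" "\<forall>i<K. \<bar>q i - a i\<bar> \<le> \<eta>" "\<bar>q K - c\<bar> \<le> \<eta>"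
        by (auto simp: eq)
      then show "\<exists>q\<in>cart N. Z w q \<and> (\<forall>i<Suc K. \<bar>q i - (a(K := c)) i\<bar> \<le> \<eta>)"
        by (intro bexI[of _ q]) (auto simp: less_Suc_eq)
    qed
    then show ?case by blast
  qed
  then show ?thesis by blast
qed

end

section \<open>Dimension\<close>

lemma openin_cart_box:
  fixes l u :: "nat \<Rightarrow> 'a::dense_linordered_ab_group"
  shows "openin (cart_top n) {w \<in> cart n. \<forall>i<n. l i < w i \<and> w i < u i}"
proof -
  have "{w \<in> cart n. \<forall>i<n. l i < w i \<and> w i < u i} = (\<Pi>\<^sub>E i\<in>{..<n}. {l i<..<u i})"
    by (auto simp: PiE_def)
  then show ?thesis by (simp add: cart_top_def openin_PiE)
qed

lemma topspace_cart_top: "topspace (cart_top n) = cart n"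
  by (simp add: cart_top_def)

context dculoas
begin

section \<open>Boxes and the product topology\<close>

lemma open_contains_interval:
  assumes "open S" "(x::'a) \<in> S"
  shows "\<exists>l u. l < x \<and> x < u \<and> {l<..<u} \<subseteq> S"
proof -
  obtain y z where "y < x" "x < z" using ex_smaller ex_greater by blast
  then obtain l u where "l < x" "{l<..x} \<subseteq> S" "x < u" "{x..<u} \<subseteq> S"
    using open_left[OF assms] open_right[OF assms] by metis
  moreover from this have "{l<..<u} \<subseteq> S"
    by (metis atLeastLessThan_iff greaterThanAtMost_iff greaterThanLessThan_iff linorder_le_cases subset_iff)
  ultimately show ?thesis by blast
qed

lemma openin_cart_contains_box:
  assumes "openin (cart_top n) U" "(w :: nat \<Rightarrow> 'a) \<in> U"
  shows "has_box n (\<lambda>w. w \<in> U)"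
proof -
  obtain X where X: "w \<in> (\<Pi>\<^sub>E i\<in>{..<n}. X i)" "\<And>i. open (X i)" "(\<Pi>\<^sub>E i\<in>{..<n}. X i) \<subseteq> U"
    using product_topology_open_contains_basis[OF assms[unfolded cart_top_def]] by auto
  have "\<exists>l u. l < w i \<and> w i < u \<and> {l<..<u} \<subseteq> X i" if "i < n" for i
    using open_contains_interval[OF X(2), of "w i"] X(1) that by auto
  then obtain l u where lu: "\<And>i. i < n \<Longrightarrow> l i < w i \<and> w i < u i \<and> {l i<..<u i} \<subseteq> X i"
    by metis
  show ?thesis
    unfolding has_box_def
  proof (intro exI conjI ballI allI impI)
    show "l i < u i" if "i < n" for i using lu[OF that] by auto
    fix w' :: "nat \<Rightarrow> 'a" assume w': "w' \<in> cart n" "\<forall>i<n. l i < w' i \<and> w' i < u i"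
    have "w' i \<in> X i" if "i < n" for i using lu[OF that] w'(2) that by auto
    then have "w' \<in> (\<Pi>\<^sub>E i\<in>{..<n}. X i)" using w'(1) by (auto simp: PiE_def)
    with X(3) show "w' \<in> U" by blast
  qed
qed

lemma has_box_ball:
  fixes X :: "(nat \<Rightarrow> 'a) \<Rightarrow> bool"
  assumes "has_box n X"
  shows "\<exists>w\<in>cart n. \<exists>\<rho>>0. \<forall>w'\<in>cart n. (\<forall>i<n. \<bar>w' i - w i\<bar> < \<rho>) \<longrightarrow> X w'"
proof -
  obtain l u where lu: "\<And>i. i < n \<Longrightarrow> l i < u i"
    "\<And>w. w \<in> cart n \<Longrightarrow> \<forall>i<n. l i < w i \<and> w i < u i \<Longrightarrow> X w"
    by (rule has_boxE[OF assms]) (rule that)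
  have "\<exists>c. l i < c \<and> c < u i" if "i < n" for i using dense[OF lu(1)[OF that]] .
  then obtain c where c: "\<And>i. i < n \<Longrightarrow> l i < c i \<and> c i < u i" by metis
  obtain e :: 'a where e: "0 < e" using nontrivial by blast
  \<comment> \<open>\<open>e\<close> keeps the set nonempty when \<open>n = 0\<close>.\<close>
  define \<rho> where "\<rho> = Min (insert e ((\<lambda>i. min (c i - l i) (u i - c i)) ` {..<n}))"
  have "0 < \<rho>" unfolding \<rho>_def using e c by (subst Min_gr_iff) auto
  moreover have "X w" if w: "w \<in> cart n" "\<forall>i<n. \<bar>w i - restrict c {..<n} i\<bar> < \<rho>" for w
  proof (rule lu(2)[OF w(1)], intro allI impI)
    fix i assume i: "i < n"
    have "\<rho> \<le> min (c i - l i) (u i - c i)" unfolding \<rho>_def using i by (intro Min_le) auto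
    then have "\<bar>w i - c i\<bar> < c i - l i" "\<bar>w i - c i\<bar> < u i - c i"
      using w(2) i by (auto dest!: spec[of _ i])
    then show "l i < w i \<and> w i < u i" by (auto simp: abs_diff_less_iff')
  qed
  moreover have "restrict c {..<n} \<in> cart n" by simp
  ultimately show ?thesis by blast
qed

lemma has_box_ex:
  fixes X :: "(nat \<Rightarrow> 'a) \<Rightarrow> bool"
  assumes "has_box n X"
  shows "\<exists>w\<in>cart n. X w"
proof -
  obtain w \<rho> where w: "w \<in> cart n" "0 < \<rho>"
    and X: "\<And>w'. w' \<in> cart n \<Longrightarrow> \<forall>i<n. \<bar>w' i - w i\<bar> < \<rho> \<Longrightarrow> X w'"
    using has_box_ball[OF assms] by blast
  have "X w" by (rule X[OF w(1)]) (use w(2) in auto)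
  with w(1) show ?thesis by blast
qed

lemma proj_dims_iff:
  "d \<in> proj_dims n (X :: (nat \<Rightarrow> 'a) set) \<longleftrightarrow>
    (\<exists>\<sigma>. strict_mono_on {..<d} \<sigma> \<and> \<sigma> ` {..<d} \<subseteq> {..<n} \<and> has_box d (\<lambda>w. w \<in> coord_proj d \<sigma> ` X))"
proof -
  have "cart_top d interior_of S \<noteq> {} \<longleftrightarrow> has_box d (\<lambda>w. w \<in> S)" if S: "S \<subseteq> cart d"
    for S :: "(nat \<Rightarrow> 'a) set"
  proof
    assume "cart_top d interior_of S \<noteq> {}"
    then obtain w where "w \<in> cart_top d interior_of S" by blast
    then have "has_box d (\<lambda>w. w \<in> cart_top d interior_of S)"
      by (rule openin_cart_contains_box[OF openin_interior_of])
    then show "has_box d (\<lambda>w. w \<in> S)"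
      by (rule has_box_mono) (rule subsetD[OF interior_of_subset])
  next
    assume box: "has_box d (\<lambda>w. w \<in> S)"
    obtain l u where lu: "\<And>i. i < d \<Longrightarrow> l i < u i"
      "\<And>w. w \<in> cart d \<Longrightarrow> \<forall>i<d. l i < w i \<and> w i < u i \<Longrightarrow> w \<in> S"
      by (rule has_boxE[OF box]) (rule that)
    have "\<exists>c. l i < c \<and> c < u i" if "i < d" for i using dense[OF lu(1)[OF that]] .
    then obtain c where c: "\<And>i. i < d \<Longrightarrow> l i < c i \<and> c i < u i" by metis
    let ?B = "{w \<in> cart d. \<forall>i<d. l i < w i \<and> w i < u i}"
    have "?B \<subseteq> cart_top d interior_of S"
      by (rule interior_of_maximal[OF _ openin_cart_box]) (use lu(2) in blast)
    moreover have "restrict c {..<d} \<in> ?B" using c by simp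
    ultimately show "cart_top d interior_of S \<noteq> {}" by blast
  qed
  moreover have "coord_proj d \<sigma> ` X \<subseteq> cart d" for \<sigma>
    by (auto simp: coord_proj_def PiE_def extensional_def)
  ultimately show ?thesis by (simp add: proj_dims_def)
qed

text \<open>In the box the new coordinate \<open>i\<close> comes last, but \<open>proj_dims\<close>
  admits increasing index maps only. The content is a permutation of the sides of the box.\<close>

lemma Suc_in_proj_dims:
  fixes X :: "(nat \<Rightarrow> 'a) set"
  assumes \<sigma>: "strict_mono_on {..<d} \<sigma>" "\<sigma> ` {..<d} \<subseteq> {..<n}" and i: "i < n" "i \<notin> \<sigma> ` {..<d}"
    and box: "has_box (Suc d) (\<lambda>w. \<exists>p\<in>X. (\<forall>j<d. p (\<sigma> j) = w j) \<and> p i = w d)"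
  shows "Suc d \<in> proj_dims n X"
proof -
  define \<tau> where "\<tau> = \<sigma>(d := i)"
  define A where "A = insert i (\<sigma> ` {..<d})"
  define \<sigma>' where "\<sigma>' k = sorted_list_of_set A ! k" for k
  have inj_\<sigma>: "inj_on \<sigma> {..<d}" using \<sigma>(1) by (rule strict_mono_on_imp_inj_on)
  have finA: "finite A" by (simp add: A_def)
  have cardA: "card A = Suc d" using i(2) by (simp add: A_def card_image[OF inj_\<sigma>])
  have len: "length (sorted_list_of_set A) = Suc d" by (simp add: cardA)
  have \<sigma>'_mono: "strict_mono_on {..<Suc d} \<sigma>'"
    unfolding strict_mono_on_def \<sigma>'_def
  proof (intro allI impI)
    fix r s assume "r \<in> {..<Suc d} \<and> s \<in> {..<Suc d} \<and> r < s"
    then show "sorted_list_of_set A ! r < sorted_list_of_set A ! s"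
      using sorted_wrt_nth_less[OF strict_sorted_list_of_set, of r s A] len by simp
  qed
  have \<sigma>'_mem: "\<sigma>' k \<in> A" if "k < Suc d" for k
    using nth_mem[of k "sorted_list_of_set A"] that finA len by (simp add: \<sigma>'_def)
  have bij\<tau>: "bij_betw \<tau> {..<Suc d} A"
    unfolding bij_betw_def
  proof
    show "inj_on \<tau> {..<Suc d}"
      using inj_\<sigma> i(2) by (auto simp: \<tau>_def lessThan_Suc inj_on_def)
    show "\<tau> ` {..<Suc d} = A"
      by (auto simp: \<tau>_def A_def lessThan_Suc)
  qed
  \<comment> \<open>The permutation with \<open>\<tau> \<circ> \<beta> = \<sigma>'\<close>, between
    the order with \<open>i\<close> appended and the increasing order.\<close>
  define \<beta> where "\<beta> k = inv_into {..<Suc d} \<tau> (\<sigma>' k)" for k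
  have \<beta>_less: "\<beta> k < Suc d" and \<tau>\<beta>: "\<tau> (\<beta> k) = \<sigma>' k" if "k < Suc d" for k
    using \<sigma>'_mem[OF that] bij\<tau> inv_into_into[of "\<sigma>' k" \<tau> "{..<Suc d}"] f_inv_into_f[of "\<sigma>' k" \<tau> "{..<Suc d}"]
    by (auto simp: \<beta>_def bij_betw_def)
  have inj_\<beta>: "inj_on \<beta> {..<Suc d}"
  proof (rule inj_onI)
    fix j k assume "j \<in> {..<Suc d}" "k \<in> {..<Suc d}" "\<beta> j = \<beta> k"
    then have "\<sigma>' j = \<sigma>' k" using \<tau>\<beta> by (metis lessThan_iff)
    with \<open>j \<in> _\<close> \<open>k \<in> _\<close> show "j = k"
      using strict_mono_on_imp_inj_on[OF \<sigma>'_mono] by (meson inj_onD)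
  qed
  then have surj_\<beta>: "\<beta> ` {..<Suc d} = {..<Suc d}"
    using \<beta>_less by (intro card_subset_eq) (auto simp: card_image)
  obtain l u where lu: "\<And>i. i < Suc d \<Longrightarrow> l i < u i"
    "\<And>w. w \<in> cart (Suc d) \<Longrightarrow> \<forall>i<Suc d. l i < w i \<and> w i < u i \<Longrightarrow>
      \<exists>p\<in>X. (\<forall>j<d. p (\<sigma> j) = w j) \<and> p i = w d"
    by (rule has_boxE[OF box]) (rule that)
  have "has_box (Suc d) (\<lambda>w. w \<in> coord_proj (Suc d) \<sigma>' ` X)"
    unfolding has_box_def
  proof (intro exI conjI allI impI ballI)
    show "l (\<beta> k) < u (\<beta> k)" if "k < Suc d" for k by (rule lu(1)[OF \<beta>_less[OF that]])
    fix w :: "nat \<Rightarrow> 'a"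
    assume w: "w \<in> cart (Suc d)" "\<forall>k<Suc d. l (\<beta> k) < w k \<and> w k < u (\<beta> k)"
    \<comment> \<open>\<open>w\<close> with its coordinates put back into the order of
      \<open>\<tau>\<close>, where the given box applies.\<close>
    define w0 where "w0 = (\<lambda>j\<in>{..<Suc d}. w (inv_into {..<Suc d} \<beta> j))"
    have w0\<beta>: "w0 (\<beta> k) = w k" if "k < Suc d" for k
      using \<beta>_less[OF that] inv_into_f_f[OF inj_\<beta>] that by (simp add: w0_def)
    have "w0 \<in> cart (Suc d)" by (simp add: w0_def)
    moreover have "l j < w0 j \<and> w0 j < u j" if j: "j < Suc d" for j
    proof -
      have "j \<in> \<beta> ` {..<Suc d}" using surj_\<beta> j by simp
      then obtain k where "k < Suc d" "j = \<beta> k" by blast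
      then show ?thesis using w(2) w0\<beta> by simp
    qed
    ultimately have "\<exists>p\<in>X. (\<forall>j<d. p (\<sigma> j) = w0 j) \<and> p i = w0 d"
      by (intro lu(2)) auto
    then obtain p where p: "p \<in> X" "\<forall>j<d. p (\<sigma> j) = w0 j" "p i = w0 d" by blast
    then have "p (\<tau> j) = w0 j" if "j < Suc d" for j
      using that by (auto simp: \<tau>_def less_Suc_eq)
    then have "p (\<sigma>' k) = w k" if "k < Suc d" for k
      using \<beta>_less[OF that] \<tau>\<beta>[OF that] w0\<beta>[OF that] by metis
    then have "coord_proj (Suc d) \<sigma>' p = w"
      using w(1) by (auto simp: coord_proj_def PiE_def extensional_def fun_eq_iff)
    with p(1) show "w \<in> coord_proj (Suc d) \<sigma>' ` X" by blast
  qed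
  moreover have "\<sigma>' ` {..<Suc d} \<subseteq> {..<n}"
    using \<sigma>'_mem \<sigma>(2) i(1) by (fastforce simp: A_def)
  ultimately show ?thesis using \<sigma>'_mono by (auto simp: proj_dims_iff)
qed

end

section \<open>Discontinuities of equicontinuous families\<close>

lemma max_norm_less_iff: "0 < \<delta> \<Longrightarrow> max_norm m x < \<delta> \<longleftrightarrow> (\<forall>i<m. \<bar>x i\<bar> < \<delta>)"
  by (auto simp: max_norm_def)

text \<open>A minimum of finitely many radii; \<open>k0\<close> covers the empty case and caps the
  result.\<close>

lemma ex_uniform_radius:
  fixes Q :: "nat \<Rightarrow> 'a::linorder \<Rightarrow> bool"
  assumes "\<And>i. i < n \<Longrightarrow> \<exists>k>z. Q i k" and "\<And>i k k'. k' \<le> k \<Longrightarrow> Q i k \<Longrightarrow> Q i k'" and "z < k0"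
  shows "\<exists>k>z. k \<le> k0 \<and> (\<forall>i<n. Q i k)"
  using assms(1)
proof (induction n)
  case 0
  then show ?case using assms(3) by auto
next
  case (Suc n)
  then obtain k where k: "k > z" "k \<le> k0" "\<forall>i<n. Q i k" by auto
  obtain k' where k': "k' > z" "Q n k'" using Suc.prems[of n] by auto
  have "Q i (min k k')" if "i < Suc n" for i
    using k(3) k'(2) that assms(2)[OF min.cobounded1] assms(2)[OF min.cobounded2]
    by (cases "i = n") (auto simp: less_Suc_eq)
  then show ?case using k k' by (intro exI[of _ "min k k'"]) (auto intro: min.coboundedI1)
qed

locale equicontinuous_family = dculoas \<M>
  for \<M> :: "('a::dense_linordered_ab_group, 'f, 'r) expansion" +
  fixes m n :: nat
    and C P :: "(nat \<Rightarrow> 'a) set"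
    and f :: "(nat \<Rightarrow> 'a) \<times> (nat \<Rightarrow> 'a) \<Rightarrow> 'a"
  assumes C: "definable \<M> m C" and P: "definable \<M> n P"
    and f: "definable_fun \<M> m n C P f"
    and equi: "equi_continuous_wrt m C P f"
begin

section \<open>Definability of graph, jumps and moduli\<close>

lemma C_cart: "x \<in> C \<Longrightarrow> x \<in> cart m"
  using C by (auto simp: definable_def)

lemma P_cart: "p \<in> P \<Longrightarrow> p \<in> cart n"
  using P by (auto simp: definable_def)

text \<open>The tuple is one restricted function, in the shape that
  \<open>definable_imp_defpred\<close> accepts.\<close>

definition graph :: "(nat \<Rightarrow> 'a) \<Rightarrow> (nat \<Rightarrow> 'a) \<Rightarrow> 'a \<Rightarrow> bool" where
  "graph x p y \<longleftrightarrow> (\<lambda>i\<in>{..<Suc (m + n)}. if i < m then x i else if i < m + n then p (i - m) else y) \<in>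
    {(join m n x p)(m + n := f (x, p)) |x p. x \<in> C \<and> p \<in> P}"

lemma graph_iff:
  assumes "x \<in> C" "p \<in> P"
  shows "graph x p y \<longleftrightarrow> y = f (x, p)"
proof -
  have eq: "(\<lambda>i\<in>{..<Suc (m + n)}. if i < m then x i else if i < m + n then p (i - m) else y) =
      (join m n x p)(m + n := y)"
    by (auto simp: join_def fun_eq_iff)
  show ?thesis
  proof
    assume "graph x p y"
    then obtain x' p' where xp: "x' \<in> C" "p' \<in> P"
      and eq': "(join m n x p)(m + n := y) = (join m n x' p')(m + n := f (x', p'))"
      unfolding graph_def eq by blast
    have "x i = x' i" if "i < m" for i
      using fun_cong[OF eq', of i] that by (simp add: join_def)
    then have x: "x = x'"
      using C_cart[OF assms(1)] C_cart[OF xp(1)] by (auto intro: PiE_ext)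
    have "p i = p' i" if "i < n" for i
      using fun_cong[OF eq', of "m + i"] that by (simp add: join_def)
    then have "p = p'"
      using P_cart[OF assms(2)] P_cart[OF xp(2)] by (auto intro: PiE_ext)
    with x fun_cong[OF eq', of "m + n"] show "y = f (x, p)" by simp
  next
    assume "y = f (x, p)"
    then show "graph x p y" unfolding graph_def eq using assms by blast
  qed
qed

lemma defpred_graph:
  assumes "\<And>i. deftrm (\<lambda>v. x v i)" "\<And>i. deftrm (\<lambda>v. p v i)" "deftrm y"
  shows "defpred (\<lambda>v. graph (x v) (p v) (y v))"
  unfolding graph_def
  by (rule definable_imp_defpred[OF f[unfolded definable_fun_def]]) (intro deftrm_if assms)

definition inC :: "(nat \<Rightarrow> 'a) \<Rightarrow> bool" where "inC x \<longleftrightarrow> restrict x {..<m} \<in> C"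

definition inP :: "(nat \<Rightarrow> 'a) \<Rightarrow> bool" where "inP p \<longleftrightarrow> restrict p {..<n} \<in> P"

lemma inC_iff: "x \<in> cart m \<Longrightarrow> inC x \<longleftrightarrow> x \<in> C"
  by (simp add: inC_def cart_restrict)

lemma inP_iff: "p \<in> cart n \<Longrightarrow> inP p \<longleftrightarrow> p \<in> P"
  by (simp add: inP_def cart_restrict)

lemma defpred_inC:
  assumes "\<And>i. deftrm (\<lambda>v. x v i)"
  shows "defpred (\<lambda>v. inC (x v))"
  unfolding inC_def by (rule definable_imp_defpred[OF C]) (rule assms)

lemma defpred_inP:
  assumes "\<And>i. deftrm (\<lambda>v. p v i)"
  shows "defpred (\<lambda>v. inP (p v))"
  unfolding inP_def by (rule definable_imp_defpred[OF P]) (rule assms)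

text \<open>A failure of continuity of \<open>f (x, _)\<close> at \<open>p\<close> with gap
  \<open>k\<close>. As \<open>f\<close> is defined only up to its graph on
  \<open>C \<times> P\<close>, its values enter as quantified elements \<open>y\<close>,
  \<open>y'\<close>.\<close>

definition jumps :: "'a \<Rightarrow> (nat \<Rightarrow> 'a) \<Rightarrow> (nat \<Rightarrow> 'a) \<Rightarrow> bool" where
  "jumps k x p \<longleftrightarrow> (\<forall>\<delta>. 0 < \<delta> \<longrightarrow> (\<exists>p'\<in>cart n. inP p' \<and> (\<forall>i<n. \<bar>p' i - p i\<bar> < \<delta>) \<and>
    (\<exists>y y'. graph x p y \<and> graph x p' y' \<and> k \<le> \<bar>y' - y\<bar>)))"

definition modulus :: "'a \<Rightarrow> 'a \<Rightarrow> (nat \<Rightarrow> 'a) \<Rightarrow> bool" where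
  "modulus \<epsilon> \<delta> x \<longleftrightarrow> (\<forall>p\<in>cart n. \<forall>x'\<in>cart m. inP p \<and> inC x' \<and> (\<forall>i<m. \<bar>x i - x' i\<bar> < \<delta>) \<longrightarrow>
    (\<exists>y y'. graph x p y \<and> graph x' p y' \<and> \<bar>y - y'\<bar> < \<epsilon>))"

lemma jumps_iff:
  assumes "x \<in> C" "p \<in> P"
  shows "jumps k x p \<longleftrightarrow>
    (\<forall>\<delta>>0. \<exists>p'\<in>P. (\<forall>i<n. \<bar>p' i - p i\<bar> < \<delta>) \<and> k \<le> \<bar>f (x, p') - f (x, p)\<bar>)"
proof -
  have "(\<exists>p'\<in>cart n. inP p' \<and> Q p' \<and> (\<exists>y y'. graph x p y \<and> graph x p' y' \<and> k \<le> \<bar>y' - y\<bar>)) \<longleftrightarrow>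
      (\<exists>p'\<in>P. Q p' \<and> k \<le> \<bar>f (x, p') - f (x, p)\<bar>)" for Q
  proof
    assume "\<exists>p'\<in>cart n. inP p' \<and> Q p' \<and> (\<exists>y y'. graph x p y \<and> graph x p' y' \<and> k \<le> \<bar>y' - y\<bar>)"
    then show "\<exists>p'\<in>P. Q p' \<and> k \<le> \<bar>f (x, p') - f (x, p)\<bar>"
      using assms by (auto simp: inP_iff graph_iff)
  next
    assume "\<exists>p'\<in>P. Q p' \<and> k \<le> \<bar>f (x, p') - f (x, p)\<bar>"
    then obtain p' where "p' \<in> P" "Q p'" "k \<le> \<bar>f (x, p') - f (x, p)\<bar>" by blast
    with assms show "\<exists>p'\<in>cart n. inP p' \<and> Q p' \<and>
        (\<exists>y y'. graph x p y \<and> graph x p' y' \<and> k \<le> \<bar>y' - y\<bar>)"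
      by (intro bexI[of _ p']) (auto simp: inP_iff graph_iff P_cart)
  qed
  then show ?thesis unfolding jumps_def by simp
qed

lemma modulus_iff:
  assumes "x \<in> C"
  shows "modulus \<epsilon> \<delta> x \<longleftrightarrow>
    (\<forall>p\<in>P. \<forall>x'\<in>C. (\<forall>i<m. \<bar>x i - x' i\<bar> < \<delta>) \<longrightarrow> \<bar>f (x, p) - f (x', p)\<bar> < \<epsilon>)"
  unfolding modulus_def using assms P_cart C_cart by (auto simp: inP_iff inC_iff graph_iff)

lemma ex_modulus:
  assumes "x \<in> C" "0 < \<epsilon>"
  shows "\<exists>\<delta>>0. modulus \<epsilon> \<delta> x"
proof -
  obtain \<delta> where \<delta>: "\<delta> > 0" "\<forall>p\<in>P. \<forall>x'\<in>C.
      max_norm m (\<lambda>i. x i - x' i) < \<delta> \<longrightarrow> \<bar>f (x, p) - f (x', p)\<bar> < \<epsilon>"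
    using equi assms unfolding equi_continuous_wrt_def by meson
  then show ?thesis by (intro exI[of _ \<delta>]) (simp add: modulus_iff assms max_norm_less_iff)
qed

text \<open>Without jumps, \<open>f (x', p')\<close> is close to \<open>f (x, p')\<close> by
  equicontinuity, uniformly in \<open>p'\<close>, and this is close to \<open>f (x, p)\<close>; so
  \<open>f\<close> would be jointly continuous.\<close>

lemma discontinuity_jumps:
  assumes "(x, p) \<in> discontinuity_set m n C P f"
  shows "\<exists>k>0. jumps k x p"
proof (rule ccontr)
  have xp: "x \<in> C" "p \<in> P" using assms by (auto simp: discontinuity_set_def)
  let ?T = "subtopology (prod_topology (cart_top m) (cart_top n)) (C \<times> P)"
  assume no_jump: "\<not> (\<exists>k>0. jumps k x p)"
  have small: "\<exists>\<delta>>0. \<forall>p'\<in>P. (\<forall>i<n. \<bar>p' i - p i\<bar> < \<delta>) \<longrightarrow> \<bar>f (x, p') - f (x, p)\<bar> < \<epsilon>"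
    if "0 < \<epsilon>" for \<epsilon>
  proof -
    have "\<not> jumps \<epsilon> x p" using no_jump that by blast
    then obtain \<delta> where "\<delta> > 0" "\<not> (\<exists>p'\<in>P. (\<forall>i<n. \<bar>p' i - p i\<bar> < \<delta>) \<and> \<epsilon> \<le> \<bar>f (x, p') - f (x, p)\<bar>)"
      unfolding jumps_iff[OF xp] by blast
    then show ?thesis using not_le by blast
  qed
  have top: "topspace ?T = C \<times> P"
    using C_cart P_cart by (auto simp: topspace_cart_top)
  have "topcontinuous_at ?T euclidean f (x, p)"
    unfolding topcontinuous_at_def top
  proof (intro conjI allI impI)
    show "(x, p) \<in> C \<times> P" using xp by simp
    fix V assume "openin euclidean V \<and> f (x, p) \<in> V"
    then have V: "open V" "f (x, p) \<in> V" by auto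
    obtain l u where lu: "l < f (x, p)" "f (x, p) < u" "{l<..<u} \<subseteq> V"
      using open_contains_interval[OF V] by blast
    have "0 < min (f (x, p) - l) (u - f (x, p))" using lu by simp
    from ex_add_self_less[OF this] obtain \<epsilon> where
      \<epsilon>: "0 < \<epsilon>" "\<epsilon> + \<epsilon> < min (f (x, p) - l) (u - f (x, p))" by blast
    obtain \<delta>1 where \<delta>1: "\<delta>1 > 0" "modulus \<epsilon> \<delta>1 x" using ex_modulus[OF xp(1) \<epsilon>(1)] by blast
    obtain \<delta>2 where \<delta>2: "\<delta>2 > 0"
      "\<And>p'. p' \<in> P \<Longrightarrow> \<forall>i<n. \<bar>p' i - p i\<bar> < \<delta>2 \<Longrightarrow> \<bar>f (x, p') - f (x, p)\<bar> < \<epsilon>"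
      using small[OF \<epsilon>(1)] by blast
    let ?U1 = "{x' \<in> cart m. \<forall>i<m. x i - \<delta>1 < x' i \<and> x' i < x i + \<delta>1}"
    let ?U2 = "{p' \<in> cart n. \<forall>i<n. p i - \<delta>2 < p' i \<and> p' i < p i + \<delta>2}"
    let ?U = "(?U1 \<times> ?U2) \<inter> (C \<times> P)"
    have "openin (prod_topology (cart_top m) (cart_top n)) (?U1 \<times> ?U2)"
      using openin_cart_box[of m "\<lambda>i. x i - \<delta>1" "\<lambda>i. x i + \<delta>1"]
        openin_cart_box[of n "\<lambda>i. p i - \<delta>2" "\<lambda>i. p i + \<delta>2"]
      by (simp add: openin_prod_Times_iff)
    then have "openin ?T ?U" by (auto simp: openin_subtopology)
    moreover have "(x, p) \<in> ?U"
      using xp C_cart P_cart \<delta>1(1) \<delta>2(1) by (simp add: less_diff_eq)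
    moreover have "f z \<in> V" if "z \<in> ?U" for z
    proof -
      obtain x' p' where z: "z = (x', p')" "x' \<in> C" "p' \<in> P"
        "\<forall>i<m. x i - \<delta>1 < x' i \<and> x' i < x i + \<delta>1" "\<forall>i<n. p i - \<delta>2 < p' i \<and> p' i < p i + \<delta>2"
        using \<open>z \<in> ?U\<close> by auto
      have "\<forall>i<m. \<bar>x i - x' i\<bar> < \<delta>1"
        using z(4) unfolding abs_minus_commute[of "x _"] abs_diff_less_iff' .
      then have "\<bar>f (x, p') - f (x', p')\<bar> < \<epsilon>"
        using \<delta>1(2) z(2,3) unfolding modulus_iff[OF xp(1)] by blast
      then have "\<bar>f (x', p') - f (x, p')\<bar> < \<epsilon>"
        by (simp only: abs_minus_commute)
      moreover have "\<bar>f (x, p') - f (x, p)\<bar> < \<epsilon>"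
        using \<delta>2(2)[OF z(3)] z(5) unfolding abs_diff_less_iff' by blast
      ultimately have "\<bar>f (x', p') - f (x, p')\<bar> + \<bar>f (x, p') - f (x, p)\<bar> < \<epsilon> + \<epsilon>"
        by (rule add_strict_mono)
      then have "\<bar>f (x', p') - f (x, p)\<bar> < min (f (x, p) - l) (u - f (x, p))"
        using abs_diff_triangle[of "f (x', p')" "f (x, p)" "f (x, p')"] \<epsilon>(2) by (meson order_le_less_trans less_trans)
      then have "\<bar>f (x', p') - f (x, p)\<bar> < f (x, p) - l" "\<bar>f (x', p') - f (x, p)\<bar> < u - f (x, p)"
        by auto
      then have "f (x', p') \<in> {l<..<u}" by (auto simp: abs_diff_less_iff')
      with lu(3) z(1) show ?thesis by auto
    qed
    ultimately show "\<exists>U. openin ?T U \<and> (x, p) \<in> U \<and> (\<forall>z\<in>U. f z \<in> V)"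
      by (intro exI[of _ ?U] conjI ballI)
  qed auto
  with assms show False by (simp add: discontinuity_set_def)
qed


lemma jumps_antimono:
  assumes "k' \<le> k" "jumps k x p"
  shows "jumps k' x p"
  unfolding jumps_def
proof (intro allI impI)
  fix \<delta> :: 'a assume "0 < \<delta>"
  then obtain p' y y' where "p' \<in> cart n" "inP p'" "\<forall>i<n. \<bar>p' i - p i\<bar> < \<delta>"
    "graph x p y" "graph x p' y'" "k \<le> \<bar>y' - y\<bar>"
    using assms(2) unfolding jumps_def by blast
  moreover from this have "k' \<le> \<bar>y' - y\<bar>" using assms(1) by (blast intro: order_trans)
  ultimately show "\<exists>p'\<in>cart n. inP p' \<and> (\<forall>i<n. \<bar>p' i - p i\<bar> < \<delta>) \<and>
      (\<exists>y y'. graph x p y \<and> graph x p' y' \<and> k' \<le> \<bar>y' - y\<bar>)" by blast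
qed

lemma modulus_antimono:
  assumes "\<delta>' < \<delta>" "modulus \<epsilon> \<delta> x"
  shows "modulus \<epsilon> \<delta>' x"
  unfolding modulus_def
proof (intro ballI impI)
  fix p x' assume "p \<in> cart n" "x' \<in> cart m" "inP p \<and> inC x' \<and> (\<forall>i<m. \<bar>x i - x' i\<bar> < \<delta>')"
  moreover from this have "\<forall>i<m. \<bar>x i - x' i\<bar> < \<delta>" using assms(1) by (blast intro: order_less_trans)
  ultimately show "\<exists>y y'. graph x p y \<and> graph x' p y' \<and> \<bar>y - y'\<bar> < \<epsilon>"
    using assms(2) unfolding modulus_def by blast
qed

lemma defpred_jumps:
  assumes "\<And>i. deftrm (\<lambda>v. x v i)" "\<And>i. deftrm (\<lambda>v. p v i)" "deftrm k"
  shows "defpred (\<lambda>v. jumps (k v) (x v) (p v))"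
  unfolding jumps_def
  by (intro defpred_intros defpred_inP defpred_graph assms[THEN deftrm_shift])

lemma defpred_modulus:
  assumes "\<And>i. deftrm (\<lambda>v. x v i)" "deftrm \<delta>"
  shows "defpred (\<lambda>v. modulus \<epsilon> (\<delta> v) (x v))"
  unfolding modulus_def
  by (intro defpred_intros defpred_inP defpred_inC defpred_graph assms[THEN deftrm_shift])

section \<open>Points of \<open>P\<close> over a coordinate projection\<close>

context
  fixes d :: nat and \<sigma> :: "nat \<Rightarrow> nat"
begin

definition over :: "(nat \<Rightarrow> 'a) \<Rightarrow> (nat \<Rightarrow> 'a) \<Rightarrow> bool" where
  "over w p \<longleftrightarrow> (\<forall>j<d. p (\<sigma> j) = w j)"

definition isolated :: "'a \<Rightarrow> (nat \<Rightarrow> 'a) \<Rightarrow> bool" where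
  "isolated k p \<longleftrightarrow> (\<forall>p'\<in>cart n. inP p' \<and> (\<forall>j<d. p' (\<sigma> j) = p (\<sigma> j)) \<and> (\<forall>i<n. \<bar>p' i - p i\<bar> < k) \<longrightarrow>
    (\<forall>i<n. p' i = p i))"

lemma isolated_antimono:
  assumes "k' \<le> k" "isolated k p"
  shows "isolated k' p"
  unfolding isolated_def
proof (intro ballI impI)
  fix p' assume "p' \<in> cart n" "inP p' \<and> (\<forall>j<d. p' (\<sigma> j) = p (\<sigma> j)) \<and> (\<forall>i<n. \<bar>p' i - p i\<bar> < k')"
  moreover from this have "\<forall>i<n. \<bar>p' i - p i\<bar> < k" using assms(1) by (blast intro: order_less_le_trans)
  ultimately show "\<forall>i<n. p' i = p i" using assms(2) unfolding isolated_def by blast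
qed

lemma isolatedD:
  assumes "isolated k p" "over w p" "over w p'" "p \<in> P" "p' \<in> P" "\<And>i. i < n \<Longrightarrow> \<bar>p' i - p i\<bar> < k"
  shows "p' = p"
proof (rule PiE_ext)
  show "p' \<in> cart n" "p \<in> cart n" by (rule P_cart, fact)+
  moreover have "inP p'" using assms(5) by (simp add: inP_iff P_cart)
  moreover have "\<forall>j<d. p' (\<sigma> j) = p (\<sigma> j)" using assms(2,3) by (simp add: over_def)
  ultimately have "\<forall>i<n. p' i = p i" using assms(1,6) unfolding isolated_def by blast
  then show "p' i = p i" if "i \<in> {..<n}" for i using that by simp
qed

text \<open>This leaves coordinate \<open>d\<close> free to carry the parameter or value in the box
  lemmas.\<close>

lemma over_upd: "over (w(d := y)) p \<longleftrightarrow> over w p"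
  by (simp add: over_def)

lemma defpred_over:
  assumes "\<And>i. deftrm (\<lambda>v. w v i)" "\<And>i. deftrm (\<lambda>v. p v i)"
  shows "defpred (\<lambda>v. over (w v) (p v))"
  unfolding over_def by (intro defpred_intros assms)

lemma defpred_isolated:
  assumes "\<And>i. deftrm (\<lambda>v. p v i)" "deftrm k"
  shows "defpred (\<lambda>v. isolated (k v) (p v))"
  unfolding isolated_def
  by (intro defpred_intros defpred_inP assms[THEN deftrm_shift])

lemmas defpred_family_intros =
  defpred_intros defpred_over defpred_isolated defpred_jumps defpred_modulus defpred_graph
  defpred_inP defpred_inC

end

end

section \<open>The drop in dimension\<close>

context equicontinuous_family
begin

lemma discontinuities_raise_dim:
  assumes \<sigma>: "strict_mono_on {..<d} \<sigma>" "\<sigma> ` {..<d} \<subseteq> {..<n}"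
    and box: "has_box d (\<lambda>w. w \<in> coord_proj d \<sigma> ` snd ` discontinuity_set m n C P f)"
  shows "Suc d \<in> proj_dims n P"
proof (rule ccontr)
  assume no_dim: "Suc d \<notin> proj_dims n P"
  let ?over = "over d \<sigma>" and ?iso = "isolated d \<sigma>"
  have box0: "has_box d (\<lambda>w. \<exists>p\<in>cart n. \<exists>x\<in>cart m. ?over w p \<and> inP p \<and> inC x \<and> (\<exists>k>0. jumps k x p))"
    using box
  proof (rule has_box_mono)
    fix w assume "w \<in> coord_proj d \<sigma> ` snd ` discontinuity_set m n C P f"
    then obtain x p where xp: "(x, p) \<in> discontinuity_set m n C P f" "w = coord_proj d \<sigma> p" by auto
    then have "x \<in> C" "p \<in> P" by (auto simp: discontinuity_set_def)
    with discontinuity_jumps[OF xp(1)] xp(2)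
    show "\<exists>p\<in>cart n. \<exists>x\<in>cart m. ?over w p \<and> inP p \<and> inC x \<and> (\<exists>k>0. jumps k x p)"
      by (intro bexI[OF bexI[OF _ C_cart] P_cart])
        (auto simp: over_def coord_proj_def inP_iff[OF P_cart] inC_iff[OF C_cart])
  qed

  define fibre where "fibre i w t \<longleftrightarrow> (\<exists>p\<in>cart n. inP p \<and> ?over w p \<and> p i = t)" for i w t
  \<comment> \<open>The condition on \<open>i\<close> stays inside the predicate so that
    \<open>has_box_avoid\<close> can run over all \<open>i < n\<close>. Outside the range of
    \<open>\<sigma>\<close>, Kuratowski-Ulam would turn the fibre intervals into a box in one more
    coordinate.\<close>
  have no_fibre: "\<not> has_box d (\<lambda>w. i \<notin> \<sigma> ` {..<d} \<and> has_interval (fibre i w))" if i: "i < n" for i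
  proof
    assume box: "has_box d (\<lambda>w. i \<notin> \<sigma> ` {..<d} \<and> has_interval (fibre i w))"
    have i\<sigma>: "i \<notin> \<sigma> ` {..<d}" using has_box_ex[OF box] by (elim bexE conjE)
    have int: "has_box d (\<lambda>w. has_interval (fibre i w))"
      using box by (rule has_box_mono) (elim conjE)
    let ?X = "\<lambda>v. fibre i v (v d)"
    have "defpred ?X"
      unfolding fibre_def by (intro defpred_family_intros)
    moreover have "has_box d (\<lambda>w. has_interval (\<lambda>t. ?X (w(d := t))))"
      using int by (simp add: fibre_def[abs_def] over_upd)
    ultimately have "has_box (Suc d) ?X" by (rule has_box_Suc)
    then have "has_box (Suc d) (\<lambda>w. \<exists>p\<in>P. (\<forall>j<d. p (\<sigma> j) = w j) \<and> p i = w d)"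
      by (rule has_box_mono) (auto simp: fibre_def over_def inP_iff)
    with no_dim Suc_in_proj_dims[OF \<sigma> i i\<sigma>] show False by blast
  qed

  have "has_box d (\<lambda>w. (\<exists>p\<in>cart n. \<exists>x\<in>cart m. ?over w p \<and> inP p \<and> inC x \<and> (\<exists>k>0. jumps k x p)) \<and>
      (\<forall>i<n. \<not> (i \<notin> \<sigma> ` {..<d} \<and> has_interval (fibre i w))))"
    unfolding fibre_def
    by (rule has_box_avoid[OF _ box0 _ no_fibre[unfolded fibre_def]])
      (intro defpred_family_intros defpred_has_interval | assumption)+
  \<comment> \<open>One \<open>k\<close> bounds both isolation and jump, since both persist for
    smaller values. The form \<open>(w(d := k)) d\<close> matches
    \<open>has_box_Baire\<close>.\<close>
  then have "has_box d (\<lambda>w. \<exists>k>0. \<exists>p\<in>cart n. \<exists>x\<in>cart m.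
      ?over (w(d := k)) p \<and> inP p \<and> inC x \<and> ?iso ((w(d := k)) d) p \<and> jumps ((w(d := k)) d) x p)"
  proof (rule has_box_mono, elim conjE bexE exE)
    fix w p x k
    assume p: "p \<in> cart n" "inP p" and x: "x \<in> cart m" "inC x" and over: "?over w p"
      and k: "0 < k" "jumps k x p"
      and fib: "\<forall>i<n. \<not> (i \<notin> \<sigma> ` {..<d} \<and> has_interval (fibre i w))"
    have "\<exists>k>0. k \<le> k0 \<and> (\<forall>i<n. \<forall>p'\<in>cart n. inP p' \<and> ?over w p' \<and> \<bar>p' i - p i\<bar> < k \<longrightarrow> p' i = p i)"
      if k0: "0 < k0" for k0
    proof (rule ex_uniform_radius[OF _ _ k0])
      fix i assume i: "i < n"
      show "\<exists>k>0. \<forall>p'\<in>cart n. inP p' \<and> ?over w p' \<and> \<bar>p' i - p i\<bar> < k \<longrightarrow> p' i = p i"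
      proof (cases "i \<in> \<sigma> ` {..<d}")
        case True
        \<comment> \<open>Such a coordinate is determined by \<open>w\<close>, so any positive
          radius does.\<close>
        then show ?thesis using over k(1) by (auto simp: over_def)
      next
        case False
        have "defpred (\<lambda>v. fibre i w (v 0))"
          unfolding fibre_def by (intro defpred_family_intros)
        then obtain k where "k > 0" "\<forall>t. 0 < \<bar>t - p i\<bar> \<and> \<bar>t - p i\<bar> < k \<longrightarrow> \<not> fibre i w t"
          using punctured_nbhd_avoids[of "fibre i w" "p i"] fib i False by blast
        moreover have "fibre i w (p' i)" if "p' \<in> cart n" "inP p'" "?over w p'" for p'
          unfolding fibre_def using that by blast
        ultimately show ?thesis by (metis eq_iff_diff_eq_0 zero_less_abs_iff)
      qed
    qed (meson order_less_le_trans)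
    from this[OF k(1)] obtain k' where k': "k' > 0" "k' \<le> k"
      "\<forall>i<n. \<forall>p'\<in>cart n. inP p' \<and> ?over w p' \<and> \<bar>p' i - p i\<bar> < k' \<longrightarrow> p' i = p i" by blast
    then have "?iso k' p"
      using over by (simp add: isolated_def over_def)
    moreover have "jumps k' x p" by (rule jumps_antimono[OF k'(2) k(2)])
    ultimately show "\<exists>k>0. \<exists>p\<in>cart n. \<exists>x\<in>cart m.
        ?over (w(d := k)) p \<and> inP p \<and> inC x \<and> ?iso ((w(d := k)) d) p \<and> jumps ((w(d := k)) d) x p"
      using p x over k'(1) by (simp add: over_upd) blast
  qed
  then have "\<exists>k>0. has_box d (\<lambda>w. \<exists>p\<in>cart n. \<exists>x\<in>cart m.
      ?over (w(d := k)) p \<and> inP p \<and> inC x \<and> ?iso ((w(d := k)) d) p \<and> jumps ((w(d := k)) d) x p)"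
  proof (rule has_box_Baire[rotated 2])
    show "defpred (\<lambda>v. \<exists>p\<in>cart n. \<exists>x\<in>cart m.
        ?over v p \<and> inP p \<and> inC x \<and> ?iso (v d) p \<and> jumps (v d) x p)"
      by (intro defpred_family_intros)
  next
    fix w r s
    assume rs: "r < s" and "\<exists>p\<in>cart n. \<exists>x\<in>cart m.
        ?over (w(d := s)) p \<and> inP p \<and> inC x \<and> ?iso ((w(d := s)) d) p \<and> jumps ((w(d := s)) d) x p"
    then obtain p x where px: "p \<in> cart n" "x \<in> cart m" "?over w p" "inP p" "inC x"
      "?iso s p" "jumps s x p"
      by (elim bexE conjE) (simp add: over_upd)
    have "?iso r p" by (rule isolated_antimono[OF less_imp_le[OF rs] px(6)])
    moreover have "jumps r x p" by (rule jumps_antimono[OF less_imp_le[OF rs] px(7)])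
    ultimately show "\<exists>p\<in>cart n. \<exists>x\<in>cart m.
        ?over (w(d := r)) p \<and> inP p \<and> inC x \<and> ?iso ((w(d := r)) d) p \<and> jumps ((w(d := r)) d) x p"
      by (intro bexI[OF bexI[OF _ px(2)] px(1)]) (simp add: over_upd px)
  qed
  then obtain k where k: "k > 0" and box1: "has_box d (\<lambda>w. \<exists>p\<in>cart n. \<exists>x\<in>cart m.
      ?over w p \<and> inP p \<and> inC x \<and> ?iso k p \<and> jumps k x p)"
    by (auto simp: over_upd)

  \<comment> \<open>Halving twice leaves room for four errors \<open>\<epsilon>\<close> below the
    jump \<open>k\<close>.\<close>
  obtain \<epsilon>' where \<epsilon>': "0 < \<epsilon>'" "\<epsilon>' + \<epsilon>' < k" using ex_add_self_less[OF k] by blast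
  obtain \<epsilon> where \<epsilon>: "0 < \<epsilon>" "\<epsilon> + \<epsilon> < \<epsilon>'" using ex_add_self_less[OF \<epsilon>'(1)] by blast
  have "has_box d (\<lambda>w. \<exists>\<delta>>0. \<exists>p\<in>cart n. \<exists>x\<in>cart m.
      ?over (w(d := \<delta>)) p \<and> inP p \<and> inC x \<and> ?iso k p \<and> jumps k x p \<and> modulus \<epsilon> ((w(d := \<delta>)) d) x)"
    using box1
  proof (rule has_box_mono, elim conjE bexE)
    fix w p x
    assume p: "p \<in> cart n" "inP p" and x: "x \<in> cart m" "inC x" and over: "?over w p"
      and iso: "?iso k p" "jumps k x p"
    obtain \<delta> where "\<delta> > 0" "modulus \<epsilon> \<delta> x"
      using ex_modulus[of x \<epsilon>] x \<epsilon>(1) by (auto simp: inC_iff)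
    then show "\<exists>\<delta>>0. \<exists>p\<in>cart n. \<exists>x\<in>cart m.
      ?over (w(d := \<delta>)) p \<and> inP p \<and> inC x \<and> ?iso k p \<and> jumps k x p \<and> modulus \<epsilon> ((w(d := \<delta>)) d) x"
      using p x over iso by (simp add: over_upd) blast
  qed
  then have "\<exists>\<delta>>0. has_box d (\<lambda>w. \<exists>p\<in>cart n. \<exists>x\<in>cart m.
      ?over (w(d := \<delta>)) p \<and> inP p \<and> inC x \<and> ?iso k p \<and> jumps k x p \<and> modulus \<epsilon> ((w(d := \<delta>)) d) x)"
  proof (rule has_box_Baire[rotated 2])
    show "defpred (\<lambda>v. \<exists>p\<in>cart n. \<exists>x\<in>cart m.
        ?over v p \<and> inP p \<and> inC x \<and> ?iso k p \<and> jumps k x p \<and> modulus \<epsilon> (v d) x)"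
      by (intro defpred_family_intros)
  next
    fix w r s
    assume rs: "r < s" and "\<exists>p\<in>cart n. \<exists>x\<in>cart m.
      ?over (w(d := s)) p \<and> inP p \<and> inC x \<and> ?iso k p \<and> jumps k x p \<and> modulus \<epsilon> ((w(d := s)) d) x"
    then obtain p x where px: "p \<in> cart n" "x \<in> cart m" "?over w p" "inP p" "inC x"
      "?iso k p" "jumps k x p" "modulus \<epsilon> s x"
      by (elim bexE conjE) (simp add: over_upd)
    have "modulus \<epsilon> r x" by (rule modulus_antimono[OF rs px(8)])
    then show "\<exists>p\<in>cart n. \<exists>x\<in>cart m.
      ?over (w(d := r)) p \<and> inP p \<and> inC x \<and> ?iso k p \<and> jumps k x p \<and> modulus \<epsilon> ((w(d := r)) d) x"
      by (intro bexI[OF bexI[OF _ px(2)] px(1)]) (simp add: over_upd px)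
  qed
  then obtain \<delta> where \<delta>: "\<delta> > 0" and box2: "has_box d (\<lambda>w. \<exists>p\<in>cart n. \<exists>x\<in>cart m.
      ?over w p \<and> inP p \<and> inC x \<and> ?iso k p \<and> jumps k x p \<and> modulus \<epsilon> \<delta> x)"
    by (auto simp: over_upd)

  \<comment> \<open>Two uses fix \<open>\<eta>\<close>: points of \<open>C\<close> within
    \<open>\<eta>\<close> of \<open>b\<close> must be within \<open>\<delta>\<close> of each other,
    and a chain of three steps in \<open>P\<close> must stay below the isolation radius
    \<open>k\<close>.\<close>
  have "0 < min k \<delta>" using k \<delta> by simp
  from ex_add_self_less[OF this] obtain \<eta>' where \<eta>': "0 < \<eta>'" "\<eta>' + \<eta>' < min k \<delta>" by blast
  obtain \<eta> where \<eta>: "0 < \<eta>" "\<eta> + \<eta> < \<eta>'" using ex_add_self_less[OF \<eta>'(1)] by blast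
  have "\<eta>' < \<eta>' + \<eta>'" using \<eta>'(1) by simp
  then have \<eta>2: "\<eta> + \<eta> < \<delta>" using \<eta>(2) \<eta>'(2) by (meson less_trans min_less_iff_conj)
  have "\<eta> + (\<eta> + \<eta>) < \<eta>' + \<eta>'"
    using \<eta> by (intro add_strict_mono) (auto intro: less_trans[of _ "\<eta> + \<eta>"])
  then have \<eta>3: "\<eta> + (\<eta> + \<eta>) < k" using \<eta>'(2) by (meson less_trans min_less_iff_conj)
  have "\<exists>a. has_box d (\<lambda>w. \<exists>p\<in>cart n. (\<exists>x\<in>cart m.
      ?over w p \<and> inP p \<and> inC x \<and> ?iso k p \<and> jumps k x p \<and> modulus \<epsilon> \<delta> x) \<and>
      (\<forall>i<n. \<bar>p i - a i\<bar> \<le> \<eta>))"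
    by (rule has_box_localize[OF _ box2 \<eta>(1)]) (intro defpred_family_intros)
  then obtain a where a: "has_box d (\<lambda>w. \<exists>p\<in>cart n. (\<exists>x\<in>cart m.
      ?over w p \<and> inP p \<and> inC x \<and> ?iso k p \<and> jumps k x p \<and> modulus \<epsilon> \<delta> x) \<and>
      (\<forall>i<n. \<bar>p i - a i\<bar> \<le> \<eta>))" by blast
  have "\<exists>b. has_box d (\<lambda>w. \<exists>x\<in>cart m. (\<exists>p\<in>cart n.
      (?over w p \<and> inP p \<and> inC x \<and> ?iso k p \<and> jumps k x p \<and> modulus \<epsilon> \<delta> x) \<and>
      (\<forall>i<n. \<bar>p i - a i\<bar> \<le> \<eta>)) \<and> (\<forall>j<m. \<bar>x j - b j\<bar> \<le> \<eta>))"
    by (rule has_box_localize[OF _ _ \<eta>(1)], intro defpred_family_intros)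
      (rule has_box_mono[OF a], blast)
  then obtain b where b: "has_box d (\<lambda>w. \<exists>x\<in>cart m. (\<exists>p\<in>cart n.
      (?over w p \<and> inP p \<and> inC x \<and> ?iso k p \<and> jumps k x p \<and> modulus \<epsilon> \<delta> x) \<and>
      (\<forall>i<n. \<bar>p i - a i\<bar> \<le> \<eta>)) \<and> (\<forall>j<m. \<bar>x j - b j\<bar> \<le> \<eta>))" by blast
  define good where "good w p x \<longleftrightarrow> p \<in> cart n \<and> x \<in> cart m \<and> ?over w p \<and> inP p \<and> inC x \<and>
    ?iso k p \<and> jumps k x p \<and> modulus \<epsilon> \<delta> x \<and> (\<forall>i<n. \<bar>p i - a i\<bar> \<le> \<eta>) \<and> (\<forall>j<m. \<bar>x j - b j\<bar> \<le> \<eta>)"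
    for w p x
  have box3: "has_box d (\<lambda>w. \<exists>p x. good w p x)"
    using b by (rule has_box_mono) (auto simp: good_def)
  \<comment> \<open>\<open>x0\<close> is fixed for good. The modulus that compares it with another
    good \<open>x\<close> is that of \<open>x\<close>.\<close>
  then obtain w0 p0 x0 where "good w0 p0 x0"
    using has_box_ex by blast
  then have x0: "x0 \<in> C" "\<And>j. j < m \<Longrightarrow> \<bar>x0 j - b j\<bar> \<le> \<eta>"
    by (auto simp: good_def inC_iff)

  let ?S = "\<lambda>v. \<exists>p\<in>cart n. \<exists>x\<in>cart m. ?over v p \<and> inP p \<and> inC x \<and>
    ?iso k p \<and> jumps k x p \<and> modulus \<epsilon> \<delta> x \<and> (\<forall>i<n. \<bar>p i - a i\<bar> \<le> \<eta>) \<and> (\<forall>j<m. \<bar>x j - b j\<bar> \<le> \<eta>) \<and>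
    graph x0 p (v d)"
  have S: "?S (w(d := y)) \<longleftrightarrow> (\<exists>p x. good w p x \<and> f (x0, p) = y)" for w y
  proof -
    have gr: "graph x0 p y \<longleftrightarrow> f (x0, p) = y" if "p \<in> cart n" "inP p" for p
      using that x0(1) by (auto simp: inP_iff graph_iff)
    show ?thesis
    proof
      assume "?S (w(d := y))"
      then show "\<exists>p x. good w p x \<and> f (x0, p) = y"
        unfolding good_def over_upd fun_upd_same using gr by blast
    next
      assume "\<exists>p x. good w p x \<and> f (x0, p) = y"
      then show "?S (w(d := y))"
        unfolding good_def over_upd fun_upd_same using gr by blast
    qed
  qed
  have "\<exists>c. has_box d (\<lambda>w. \<exists>y. \<bar>y - c\<bar> \<le> \<epsilon> \<and> ?S (w(d := y)))"
  proof (rule has_box_near[OF _ \<epsilon>(1)])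
    show "defpred ?S" by (intro defpred_family_intros)
    show "has_box d (\<lambda>w. \<exists>y. ?S (w(d := y)))"
      using box3 unfolding S by (rule has_box_mono) blast
  qed
  then obtain c where "has_box d (\<lambda>w. \<exists>p x. good w p x \<and> \<bar>f (x0, p) - c\<bar> \<le> \<epsilon>)"
    unfolding S by (elim exE) (rule that, erule has_box_mono, blast)
  from has_box_ball[OF this] obtain w \<rho> where w: "w \<in> cart d" and \<rho>: "\<rho> > 0"
    and ball: "\<And>w'. w' \<in> cart d \<Longrightarrow> \<forall>i<d. \<bar>w' i - w i\<bar> < \<rho> \<Longrightarrow>
      \<exists>p x. good w' p x \<and> \<bar>f (x0, p) - c\<bar> \<le> \<epsilon>"
    by blast
  obtain p x where px: "good w p x" "\<bar>f (x0, p) - c\<bar> \<le> \<epsilon>"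
    using ball[OF w] \<rho> by auto
  have mem: "p \<in> P" "x \<in> C" using px(1) by (auto simp: good_def inP_iff inC_iff)
  \<comment> \<open>\<open>\<rho>\<close> keeps the projection of \<open>p'\<close> in the ball;
    \<open>\<eta>\<close> keeps \<open>p'\<close> close enough to \<open>a\<close> for
    isolation.\<close>
  have "0 < min \<eta> \<rho>" using \<eta>(1) \<rho> by simp
  with px(1) obtain p' where p': "p' \<in> P" "\<forall>i<n. \<bar>p' i - p i\<bar> < min \<eta> \<rho>"
    "k \<le> \<bar>f (x, p') - f (x, p)\<bar>"
    unfolding good_def jumps_iff[OF mem(2,1)] by blast
  have over_p: "?over w p" using px(1) by (simp add: good_def)
  define w' where "w' = coord_proj d \<sigma> p'"
  have over_p': "?over w' p'" by (simp add: over_def w'_def coord_proj_def)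
  have "\<bar>w' j - w j\<bar> < \<rho>" if "j < d" for j
  proof -
    have "\<sigma> j < n" using \<sigma>(2) that by auto
    then have "\<bar>p' (\<sigma> j) - p (\<sigma> j)\<bar> < \<rho>" using p'(2) by auto
    then show ?thesis using over_p over_p' that by (simp add: over_def)
  qed
  moreover have "w' \<in> cart d" by (simp add: w'_def coord_proj_def)
  ultimately obtain p'' x'' where p'': "good w' p'' x''" "\<bar>f (x0, p'') - c\<bar> \<le> \<epsilon>"
    using ball by blast
  \<comment> \<open>\<open>p'\<close> comes from the jump and is not known to be good. The good
    point over the same \<open>w'\<close> is isolated in its fibre, which contains \<open>p'\<close>
    as well.\<close>
  have eq: "p' = p''"
  proof (rule isolatedD)
    show "?iso k p''" "?over w' p''" "?over w' p'" "p'' \<in> P" "p' \<in> P"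
      using p'' p'(1) over_p' by (auto simp: good_def inP_iff)
    fix i assume i: "i < n"
    have "\<bar>p' i - p'' i\<bar> \<le> \<bar>p' i - p i\<bar> + (\<bar>p i - a i\<bar> + \<bar>a i - p'' i\<bar>)"
      using abs_diff_triangle[of "p' i" "p'' i" "p i"] abs_diff_triangle[of "p i" "p'' i" "a i"]
      by (meson add_left_mono order_trans)
    also have "\<dots> \<le> \<eta> + (\<eta> + \<eta>)"
      using p'(2) px(1) p''(1) i by (intro add_mono) (auto simp: good_def abs_minus_commute intro: less_imp_le)
    finally show "\<bar>p' i - p'' i\<bar> < k" using \<eta>3 by simp
  qed
  have near: "\<bar>f (x, q) - f (x0, q)\<bar> \<le> \<epsilon>" if "q \<in> P" for q
  proof -
    have "\<bar>x j - x0 j\<bar> < \<delta>" if "j < m" for j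
    proof -
      have "\<bar>x j - x0 j\<bar> \<le> \<bar>x j - b j\<bar> + \<bar>b j - x0 j\<bar>" by (rule abs_diff_triangle)
      also have "\<dots> \<le> \<eta> + \<eta>"
        using px(1) x0(2)[OF that] that by (intro add_mono) (auto simp: good_def abs_minus_commute)
      finally show ?thesis using \<eta>2 by simp
    qed
    moreover have "modulus \<epsilon> \<delta> x" using px(1) by (simp add: good_def)
    ultimately show ?thesis
      using that x0(1) mem(2) by (auto simp: modulus_iff intro: less_imp_le)
  qed
  have "\<bar>f (x, p') - f (x, p)\<bar> \<le> \<bar>f (x, p') - c\<bar> + \<bar>c - f (x, p)\<bar>" by (rule abs_diff_triangle)
  also have "\<dots> \<le> (\<bar>f (x, p') - f (x0, p')\<bar> + \<bar>f (x0, p') - c\<bar>) +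
      (\<bar>c - f (x0, p)\<bar> + \<bar>f (x0, p) - f (x, p)\<bar>)"
    by (intro add_mono abs_diff_triangle)
  also have "\<dots> \<le> (\<epsilon> + \<epsilon>) + (\<epsilon> + \<epsilon>)"
    using near[OF p'(1)] near[OF mem(1)] px(2) p''(2) eq
    by (intro add_mono) (auto simp: abs_minus_commute)
  also have "\<dots> < \<epsilon>' + \<epsilon>'" using \<epsilon>(2) by (intro add_strict_mono)
  finally show False using \<epsilon>'(2) p'(3) by simp
qed

lemma dim_discontinuities_less:
  assumes "P \<noteq> {}"
  shows "def_dim n (snd ` discontinuity_set m n C P f) < def_dim n P"
proof (rule ccontr)
  let ?E = "snd ` discontinuity_set m n C P f"
  assume nless: "\<not> def_dim n ?E < def_dim n P"
  \<comment> \<open>For empty \<open>?E\<close> the dimension is \<open>Minf\<close>, which is below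
    that of the nonempty \<open>P\<close>.\<close>
  then have "?E \<noteq> {}" and le: "Max (proj_dims n P) \<le> Max (proj_dims n ?E)"
    using assms by (auto simp: def_dim_def not_less split: if_splits)
  define d where "d = Max (proj_dims n ?E)"
  have "d \<in> proj_dims n ?E"
    unfolding d_def using finite_proj_dims zero_in_proj_dims[OF \<open>?E \<noteq> {}\<close>] by (intro Max_in) auto
  then obtain \<sigma> where "strict_mono_on {..<d} \<sigma>" "\<sigma> ` {..<d} \<subseteq> {..<n}"
    "has_box d (\<lambda>w. w \<in> coord_proj d \<sigma> ` ?E)"
    unfolding proj_dims_iff by blast
  then have "Suc d \<in> proj_dims n P" by (rule discontinuities_raise_dim)
  then have "Suc d \<le> Max (proj_dims n P)" using finite_proj_dims by (intro Max_ge)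
  with le show False by (simp add: d_def)
qed

end

text \<open>Without positive elements the group has one point, and every map into it is
  continuous.\<close>

lemma discontinuity_set_trivial_group:
  fixes f :: "(nat \<Rightarrow> 'a::dense_linordered_ab_group) \<times> (nat \<Rightarrow> 'a) \<Rightarrow> 'a"
  assumes "\<not> (\<exists>e::'a. 0 < e)" and "C \<subseteq> cart m" and "P \<subseteq> cart n"
  shows "discontinuity_set m n C P f = {}"
proof -
  have "x = 0" for x :: 'a
    using assms(1) by (metis linorder_neqE neg_0_less_iff_less)
  then have eq: "x = y" for x y :: 'a by metis
  have "topcontinuous_at X euclidean f z" if "z \<in> topspace X" for X z
    unfolding topcontinuous_at_def
  proof (intro conjI allI impI)
    fix V assume "openin euclidean V \<and> f z \<in> V"
    then have "\<forall>y\<in>topspace X. f y \<in> V" using eq by metis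
    with that show "\<exists>U. openin X U \<and> z \<in> U \<and> (\<forall>y\<in>U. f y \<in> V)" by blast
  qed (use that in auto)
  moreover have "C \<times> P \<subseteq> topspace (subtopology (prod_topology (cart_top m) (cart_top n)) (C \<times> P))"
    if "C \<subseteq> cart m" "P \<subseteq> cart n"
    using that by (auto simp: topspace_cart_top)
  ultimately show ?thesis using assms(2,3) by (auto simp: discontinuity_set_def)
qed

theorem theorem4p12:
  fixes \<M> :: "('a::dense_linordered_ab_group, 'f, 'r) expansion"
    and m n :: nat
    and C P :: "(nat \<Rightarrow> 'a) set"
    and f :: "(nat \<Rightarrow> 'a) \<times> (nat \<Rightarrow> 'a) \<Rightarrow> 'a"
  assumes "DCULOAS \<M>"
    and "definable \<M> m C" and "closedin (cart_top m) C" and "bounded_in m C"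
    and "definable \<M> n P" and "P \<noteq> {}"
    and "definable_fun \<M> m n C P f"
    and "equi_continuous_wrt m C P f"
  shows "def_dim n (snd ` discontinuity_set m n C P f) < def_dim n P"
proof (cases "\<exists>e::'a. 0 < e")
  case True
  interpret equicontinuous_family \<M> m n C P f
    by unfold_locales (use assms True in auto)
  show ?thesis by (rule dim_discontinuities_less[OF assms(6)])
next
  case False
  moreover have "C \<subseteq> cart m" "P \<subseteq> cart n" using assms(2,5) by (auto simp only: definable_def)
  ultimately show ?thesis using assms(6) by (simp add: discontinuity_set_trivial_group def_dim_def)
qed

end
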